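(* The theory $\mathrm{ZF} - \mathrm{Union}$ does not prove the Finite Union principle, i.e. the statement that for every finite family $\mathcal{F}$ the union $\bigcup \mathcal{F}$ is a set. In particular, there is a model of $\mathrm{ZF} - \mathrm{Union}$ containing sets $x, y$ such that $x \cup y$ is not a set in that model.
   Context: $\mathrm{ZF} - \mathrm{Union}$ is the theory consisting of all axioms of $\mathrm{ZF}$ (Extensionality, Foundation, Pairing, Comprehension schema, Replacement schema, Power Set, Infinity) except the Union axiom. The result is proved with $\mathrm{ZF}$ as the metatheory. *)

theory Defs
  imports Main
begin

section \<open>First-order logic over the language of set theory\<close>

text \<open>Formulas use de Bruijn indices: under a quantifier, index \<open>0\<close> is the bound variable and
  index \<open>Suc k\<close> is what was index \<open>k\<close> outside.  The only terms are variables.\<close>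

datatype fm = Mem nat nat | Eq nat nat | Fls | Imp fm fm | All fm

definition Neg :: "fm \<Rightarrow> fm" where "Neg p = Imp p Fls"
definition Or :: "fm \<Rightarrow> fm \<Rightarrow> fm" where "Or p q = Imp (Neg p) q"
definition And :: "fm \<Rightarrow> fm \<Rightarrow> fm" where "And p q = Neg (Imp p (Neg q))"
definition Iff :: "fm \<Rightarrow> fm \<Rightarrow> fm" where "Iff p q = And (Imp p q) (Imp q p)"
definition Ex :: "fm \<Rightarrow> fm" where "Ex p = Neg (All (Neg p))"

definition AllIn :: "nat \<Rightarrow> fm \<Rightarrow> fm" where "AllIn a p = All (Imp (Mem 0 (Suc a)) p)"
definition ExIn :: "nat \<Rightarrow> fm \<Rightarrow> fm" where "ExIn a p = Ex (And (Mem 0 (Suc a)) p)"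

primrec fv :: "fm \<Rightarrow> nat set" where
  "fv (Mem x y) = {x, y}"
| "fv (Eq x y) = {x, y}"
| "fv Fls = {}"
| "fv (Imp p q) = fv p \<union> fv q"
| "fv (All p) = {n. Suc n \<in> fv p}"

primrec rename :: "(nat \<Rightarrow> nat) \<Rightarrow> fm \<Rightarrow> fm" where
  "rename f (Mem x y) = Mem (f x) (f y)"
| "rename f (Eq x y) = Eq (f x) (f y)"
| "rename f Fls = Fls"
| "rename f (Imp p q) = Imp (rename f p) (rename f q)"
| "rename f (All p) = All (rename (case_nat 0 (\<lambda>k. Suc (f k))) p)"

definition lift :: "fm \<Rightarrow> fm" where "lift = rename Suc"

definition inst :: "fm \<Rightarrow> nat \<Rightarrow> fm" where "inst p x = rename (case_nat x (\<lambda>k. k)) p"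

text \<open>Natural deduction for classical first-order logic with equality.\<close>

inductive proves :: "fm set \<Rightarrow> fm \<Rightarrow> bool" (infix \<open>\<turnstile>\<close> 50) where
  Assm: "p \<in> G \<Longrightarrow> G \<turnstile> p"
| ImpI: "insert p G \<turnstile> q \<Longrightarrow> G \<turnstile> Imp p q"
| ImpE: "G \<turnstile> Imp p q \<Longrightarrow> G \<turnstile> p \<Longrightarrow> G \<turnstile> q"
| Contr: "insert (Neg p) G \<turnstile> Fls \<Longrightarrow> G \<turnstile> p"
| AllI: "lift ` G \<turnstile> p \<Longrightarrow> G \<turnstile> All p"
| AllE: "G \<turnstile> All p \<Longrightarrow> G \<turnstile> inst p x"
| EqRefl: "G \<turnstile> Eq x x"
| EqSubst: "G \<turnstile> Eq x y \<Longrightarrow> G \<turnstile> inst p x \<Longrightarrow> G \<turnstile> inst p y"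

text \<open>Tarski satisfaction in the structure with domain \<open>M\<close> and membership relation \<open>E\<close>
  (\<open>E x y\<close> reads: \<open>x\<close> is a member of \<open>y\<close>).\<close>

primrec sat :: "'a set \<Rightarrow> ('a \<Rightarrow> 'a \<Rightarrow> bool) \<Rightarrow> (nat \<Rightarrow> 'a) \<Rightarrow> fm \<Rightarrow> bool" where
  "sat M E s (Mem x y) \<longleftrightarrow> E (s x) (s y)"
| "sat M E s (Eq x y) \<longleftrightarrow> s x = s y"
| "sat M E s Fls \<longleftrightarrow> False"
| "sat M E s (Imp p q) \<longleftrightarrow> (sat M E s p \<longrightarrow> sat M E s q)"
| "sat M E s (All p) \<longleftrightarrow> (\<forall>a\<in>M. sat M E (case_nat a s) p)"

definition is_model :: "'a set \<Rightarrow> ('a \<Rightarrow> 'a \<Rightarrow> bool) \<Rightarrow> fm set \<Rightarrow> bool" where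
  "is_model M E T \<longleftrightarrow> M \<noteq> {} \<and> (\<forall>p\<in>T. \<forall>s. range s \<subseteq> M \<longrightarrow> sat M E s p)"

lemma sat_derived [simp]:
  "sat M E s (Neg p) \<longleftrightarrow> \<not> sat M E s p"
  "sat M E s (Or p q) \<longleftrightarrow> sat M E s p \<or> sat M E s q"
  "sat M E s (And p q) \<longleftrightarrow> sat M E s p \<and> sat M E s q"
  "sat M E s (Iff p q) \<longleftrightarrow> (sat M E s p \<longleftrightarrow> sat M E s q)"
  "sat M E s (Ex p) \<longleftrightarrow> (\<exists>a\<in>M. sat M E (case_nat a s) p)"
  "sat M E s (AllIn x p) \<longleftrightarrow> (\<forall>a\<in>M. E a (s x) \<longrightarrow> sat M E (case_nat a s) p)"
  "sat M E s (ExIn x p) \<longleftrightarrow> (\<exists>a\<in>M. E a (s x) \<and> sat M E (case_nat a s) p)"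
  by (auto simp: Neg_def Or_def And_def Iff_def Ex_def AllIn_def ExIn_def)

lemma sat_rename: "sat M E s (rename f p) \<longleftrightarrow> sat M E (\<lambda>k. s (f k)) p"
proof (induction p arbitrary: s f)
  case (All p)
  have "(\<lambda>k. case_nat a s (case_nat 0 (\<lambda>k. Suc (f k)) k)) = case_nat a (\<lambda>k. s (f k))" for a
    by (auto split: nat.split)
  then show ?case by (simp add: All.IH)
qed auto

section \<open>The axioms\<close>

definition Extensionality :: fm where
  "Extensionality = All (All (Imp (All (Iff (Mem 0 2) (Mem 0 1))) (Eq 1 0)))"

definition Foundation :: fm where
  "Foundation = All (Imp (Ex (Mem 0 1)) (ExIn 0 (Neg (ExIn 1 (Mem 0 1)))))"

definition is_upair :: "nat \<Rightarrow> nat \<Rightarrow> nat \<Rightarrow> fm" where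
  "is_upair z x y = All (Iff (Mem 0 (Suc z)) (Or (Eq 0 (Suc x)) (Eq 0 (Suc y))))"

definition Pairing :: fm where
  "Pairing = All (All (Ex (is_upair 0 2 1)))"

definition is_bigunion :: "nat \<Rightarrow> nat \<Rightarrow> fm" where
  "is_bigunion u F = All (Iff (Mem 0 (Suc u)) (ExIn (Suc F) (Mem 1 0)))"

definition Union :: fm where
  "Union = All (Ex (is_bigunion 0 1))"

definition Power_Set :: fm where
  "Power_Set = All (Ex (All (Iff (Mem 0 1) (AllIn 0 (Mem 0 3)))))"

definition is_empty :: "nat \<Rightarrow> fm" where
  "is_empty z = All (Neg (Mem 0 (Suc z)))"

definition is_succ :: "nat \<Rightarrow> nat \<Rightarrow> fm" where
  "is_succ z y = All (Iff (Mem 0 (Suc z)) (Or (Mem 0 (Suc y)) (Eq 0 (Suc y))))"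

definition is_inductive :: "nat \<Rightarrow> fm" where
  "is_inductive I = And (ExIn I (is_empty 0)) (AllIn I (ExIn (Suc I) (is_succ 0 1)))"

definition Infinity :: fm where
  "Infinity = Ex (is_inductive 0)"

text \<open>In \<open>Comprehension_body p\<close>, the formula \<open>p\<close> has index \<open>0\<close> for the element, index \<open>1\<close> for the
  given set and indices \<open>\<ge> 2\<close> for parameters; in \<open>Replacement_body p\<close> it has index \<open>0\<close> for the
  value, index \<open>1\<close> for the argument, index \<open>2\<close> for the given set and indices \<open>\<ge> 3\<close> for parameters.
  The renamings skip the additional bound variables, so the set asserted to exist is not
  free in \<open>p\<close>.  The lemmas \<open>sat_Comprehension_body\<close> and \<open>sat_Replacement_body\<close> below state the
  meaning.\<close>

definition Comprehension_body :: "fm \<Rightarrow> fm" where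
  "Comprehension_body p =
     All (Ex (All (Iff (Mem 0 1) (And (Mem 0 2) (rename (case_nat 0 (\<lambda>k. Suc (Suc k))) p)))))"

definition Replacement_body :: "fm \<Rightarrow> fm" where
  "Replacement_body p =
     All (Imp
       (AllIn 0 (All (All (Imp
          (And (rename Suc p) (rename (case_nat 0 (\<lambda>k. Suc (Suc k))) p))
          (Eq 1 0)))))
       (Ex (All (Iff (Mem 0 1)
          (ExIn 2 (rename (case_nat (Suc 0) (case_nat 0 (\<lambda>k. Suc (Suc (Suc k))))) p))))))"

definition closures :: "fm \<Rightarrow> fm set" where
  "closures p = {(All ^^ n) p | n. fv ((All ^^ n) p) = {}}"

definition ZF_minus_Union :: "fm set" where
  "ZF_minus_Union =
     {Extensionality, Foundation, Pairing, Power_Set, Infinity}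
     \<union> (\<Union>p. closures (Comprehension_body p))
     \<union> (\<Union>p. closures (Replacement_body p))"

definition ZF :: "fm set" where
  "ZF = insert Union ZF_minus_Union"

section \<open>The Finite Union principle\<close>

text \<open>A natural number is a member of every inductive set; ordered pairs are Kuratowski pairs; a
  set is finite if some natural number is mapped onto it by a bijection.\<close>

definition is_nat :: "nat \<Rightarrow> fm" where
  "is_nat n = All (Imp (is_inductive 0) (Mem (Suc n) 0))"

definition is_opair :: "nat \<Rightarrow> nat \<Rightarrow> nat \<Rightarrow> fm" where
  "is_opair z x y = Ex (Ex (And (is_upair 1 (x + 2) (x + 2))
     (And (is_upair 0 (x + 2) (y + 2)) (is_upair (z + 2) 1 0))))"

definition maps_to :: "nat \<Rightarrow> nat \<Rightarrow> nat \<Rightarrow> fm" where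
  "maps_to f x y = ExIn f (is_opair 0 (Suc x) (Suc y))"

definition is_bijection :: "nat \<Rightarrow> nat \<Rightarrow> nat \<Rightarrow> fm" where
  "is_bijection f A B =
     And (AllIn f (ExIn (A + 1) (ExIn (B + 2) (is_opair 2 1 0))))
    (And (AllIn A (ExIn (B + 1) (maps_to (f + 2) 1 0)))
    (And (All (All (All (Imp (And (maps_to (f + 3) 2 1) (maps_to (f + 3) 2 0)) (Eq 1 0)))))
    (And (AllIn B (ExIn (A + 1) (maps_to (f + 2) 0 1)))
         (All (All (All (Imp (And (maps_to (f + 3) 2 0) (maps_to (f + 3) 1 0)) (Eq 2 1))))))))"

definition is_finite :: "nat \<Rightarrow> fm" where
  "is_finite F = Ex (And (is_nat 0) (Ex (is_bijection 0 1 (F + 2))))"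

definition Finite_Union :: fm where
  "Finite_Union = All (Imp (is_finite 0) (Ex (is_bigunion 0 1)))"

section \<open>Meaning of the formulas\<close>

lemma sat_Extensionality:
  "sat M E s Extensionality \<longleftrightarrow>
     (\<forall>x\<in>M. \<forall>y\<in>M. (\<forall>z\<in>M. E z x \<longleftrightarrow> E z y) \<longrightarrow> x = y)"
  by (simp add: Extensionality_def numeral_2_eq_2)

lemma sat_Foundation:
  "sat M E s Foundation \<longleftrightarrow>
     (\<forall>x\<in>M. (\<exists>y\<in>M. E y x) \<longrightarrow> (\<exists>y\<in>M. E y x \<and> \<not> (\<exists>z\<in>M. E z x \<and> E z y)))"
  by (simp add: Foundation_def)

lemma sat_is_upair:
  "sat M E s (is_upair z x y) \<longleftrightarrow> (\<forall>w\<in>M. E w (s z) \<longleftrightarrow> w = s x \<or> w = s y)"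
  by (simp add: is_upair_def)

lemma sat_Pairing:
  "sat M E s Pairing \<longleftrightarrow> (\<forall>x\<in>M. \<forall>y\<in>M. \<exists>z\<in>M. \<forall>w\<in>M. E w z \<longleftrightarrow> w = x \<or> w = y)"
  by (simp add: Pairing_def sat_is_upair numeral_2_eq_2)

lemma sat_is_bigunion:
  "sat M E s (is_bigunion u F) \<longleftrightarrow> (\<forall>w\<in>M. E w (s u) \<longleftrightarrow> (\<exists>x\<in>M. E x (s F) \<and> E w x))"
  by (simp add: is_bigunion_def)

lemma sat_Union:
  "sat M E s Union \<longleftrightarrow> (\<forall>F\<in>M. \<exists>u\<in>M. \<forall>w\<in>M. E w u \<longleftrightarrow> (\<exists>x\<in>M. E x F \<and> E w x))"
  by (simp add: Union_def sat_is_bigunion)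

lemma sat_Power_Set:
  "sat M E s Power_Set \<longleftrightarrow>
     (\<forall>x\<in>M. \<exists>P\<in>M. \<forall>y\<in>M. E y P \<longleftrightarrow> (\<forall>z\<in>M. E z y \<longrightarrow> E z x))"
  by (simp add: Power_Set_def numeral_3_eq_3)

lemma sat_is_empty: "sat M E s (is_empty z) \<longleftrightarrow> (\<forall>w\<in>M. \<not> E w (s z))"
  by (simp add: is_empty_def)

lemma sat_is_succ:
  "sat M E s (is_succ z y) \<longleftrightarrow> (\<forall>w\<in>M. E w (s z) \<longleftrightarrow> E w (s y) \<or> w = s y)"
  by (simp add: is_succ_def)

lemma sat_is_inductive:
  "sat M E s (is_inductive I) \<longleftrightarrow>
     (\<exists>z\<in>M. E z (s I) \<and> (\<forall>w\<in>M. \<not> E w z)) \<and>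
     (\<forall>y\<in>M. E y (s I) \<longrightarrow> (\<exists>z\<in>M. E z (s I) \<and> (\<forall>w\<in>M. E w z \<longleftrightarrow> E w y \<or> w = y)))"
  by (simp add: is_inductive_def sat_is_empty sat_is_succ)

lemma sat_Infinity:
  "sat M E s Infinity \<longleftrightarrow>
     (\<exists>I\<in>M. (\<exists>z\<in>M. E z I \<and> (\<forall>w\<in>M. \<not> E w z)) \<and>
       (\<forall>y\<in>M. E y I \<longrightarrow> (\<exists>z\<in>M. E z I \<and> (\<forall>w\<in>M. E w z \<longleftrightarrow> E w y \<or> w = y))))"
  by (simp add: Infinity_def sat_is_inductive)

lemma sat_Comprehension_body:
  "sat M E s (Comprehension_body p) \<longleftrightarrow>
     (\<forall>a\<in>M. \<exists>b\<in>M. \<forall>x\<in>M. E x b \<longleftrightarrow> E x a \<and> sat M E (case_nat x (case_nat a s)) p)"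
proof -
  have "(\<lambda>k. case_nat x (case_nat b (case_nat a s)) (case_nat 0 (\<lambda>k. Suc (Suc k)) k))
      = case_nat x (case_nat a s)" for x a b
    by (auto split: nat.split)
  then show ?thesis
    by (simp add: Comprehension_body_def sat_rename numeral_2_eq_2)
qed

lemma sat_Replacement_body:
  "sat M E s (Replacement_body p) \<longleftrightarrow>
     (\<forall>a\<in>M.
       (\<forall>x\<in>M. E x a \<longrightarrow>
          (\<forall>y\<in>M. \<forall>z\<in>M. sat M E (case_nat y (case_nat x (case_nat a s))) p \<and>
                          sat M E (case_nat z (case_nat x (case_nat a s))) p \<longrightarrow> y = z)) \<longrightarrow>
       (\<exists>b\<in>M. \<forall>y\<in>M. E y b \<longleftrightarrow>
          (\<exists>x\<in>M. E x a \<and> sat M E (case_nat y (case_nat x (case_nat a s))) p)))"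
proof -
  have 1: "(\<lambda>k. case_nat z (case_nat y t) (case_nat 0 (\<lambda>k. Suc (Suc k)) k)) = case_nat z t"
    for y z and t :: "nat \<Rightarrow> 'a"
    by (auto split: nat.split)
  have 2: "(\<lambda>k. case_nat x (case_nat y (case_nat b (case_nat a s)))
               (case_nat (Suc 0) (case_nat 0 (\<lambda>k. Suc (Suc (Suc k)))) k))
      = case_nat y (case_nat x (case_nat a s))" for x y a b
    by (auto split: nat.split simp: numeral_3_eq_3)
  show ?thesis
    using 1 2 by (simp add: Replacement_body_def sat_rename numeral_2_eq_2 numeral_3_eq_3)
qed

lemma sat_is_nat:
  "sat M E s (is_nat n) \<longleftrightarrow>
     (\<forall>I\<in>M. sat M E (case_nat I s) (is_inductive 0) \<longrightarrow> E (s n) I)"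
  by (simp add: is_nat_def)

lemma sat_is_opair:
  "sat M E s (is_opair z x y) \<longleftrightarrow>
     (\<exists>u\<in>M. \<exists>v\<in>M. (\<forall>w\<in>M. E w u \<longleftrightarrow> w = s x) \<and> (\<forall>w\<in>M. E w v \<longleftrightarrow> w = s x \<or> w = s y) \<and>
        (\<forall>w\<in>M. E w (s z) \<longleftrightarrow> w = u \<or> w = v))"
  by (simp add: is_opair_def sat_is_upair numeral_2_eq_2)

lemma sat_Finite_Union:
  "sat M E s Finite_Union \<longleftrightarrow>
     (\<forall>F\<in>M. sat M E (case_nat F s) (is_finite 0) \<longrightarrow>
        (\<exists>u\<in>M. \<forall>w\<in>M. E w u \<longleftrightarrow> (\<exists>x\<in>M. E x F \<and> E w x)))"
  by (simp add: Finite_Union_def sat_is_bigunion)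

text \<open>The bijection formula, with \<open>op p x y\<close> for: \<open>p\<close> is the ordered pair of \<open>x\<close> and \<open>y\<close> in \<open>M\<close>.\<close>

lemma sat_is_bijection:
  fixes M :: "'a set" and E :: "'a \<Rightarrow> 'a \<Rightarrow> bool"
  defines "op \<equiv> \<lambda>p x y. \<exists>u\<in>M. \<exists>v\<in>M. (\<forall>w\<in>M. E w u \<longleftrightarrow> w = x) \<and>
     (\<forall>w\<in>M. E w v \<longleftrightarrow> w = x \<or> w = y) \<and> (\<forall>w\<in>M. E w p \<longleftrightarrow> w = u \<or> w = v)"
  defines "app \<equiv> \<lambda>f x y. \<exists>p\<in>M. E p f \<and> op p x y"
  shows "sat M E s (is_bijection f A B) \<longleftrightarrow>
     (\<forall>p\<in>M. E p (s f) \<longrightarrow> (\<exists>x\<in>M. E x (s A) \<and> (\<exists>y\<in>M. E y (s B) \<and> op p x y))) \<and>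
     (\<forall>x\<in>M. E x (s A) \<longrightarrow> (\<exists>y\<in>M. E y (s B) \<and> app (s f) x y)) \<and>
     (\<forall>x\<in>M. \<forall>y\<in>M. \<forall>z\<in>M. app (s f) x y \<and> app (s f) x z \<longrightarrow> y = z) \<and>
     (\<forall>y\<in>M. E y (s B) \<longrightarrow> (\<exists>x\<in>M. E x (s A) \<and> app (s f) x y)) \<and>
     (\<forall>x\<in>M. \<forall>y\<in>M. \<forall>z\<in>M. app (s f) x z \<and> app (s f) y z \<longrightarrow> x = y)"
  unfolding is_bijection_def maps_to_def app_def op_def
  by (simp add: sat_is_opair numeral_2_eq_2 numeral_3_eq_3)

end

theory Submission
  imports Defs "HOL-Library.Countable_Set"
begin

text \<open>
  Inside the given model of ZF we build a permutation model in which the urelements are replaced by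
  nodes of binary trees without leaves. Foundation survives because the levels of the nodes in a single
  set are bounded: without Union, transitive closures need not exist. A node is a triple
  \<open>(k, m, p)\<close> where \<open>k \<in> \<omega> \<times> 2\<close>, \<open>m \<in> \<omega>\<close> and \<open>p\<close> is a subset of its area \<open>{k} \<union> m \<times> 2\<close>; its members
  are the nodes \<open>(k, m + 1, p')\<close> such that \<open>p'\<close> restricts to \<open>p\<close>. Every set \<open>g\<close> acts on the nodes
  by taking the symmetric difference of \<open>p\<close> with the part of \<open>g\<close> in the area, and this action extends
  to all sets over the nodes. It is abelian and involutive, so every stabilizer is normal.

  A set belongs to the model if, hereditarily, it is fixed by all \<open>g\<close> disjoint from some \<open>m \<times> 2\<close>, and
  there are \<open>m \<in> \<omega>\<close> and \<open>i < 2\<close> such that all its members are fixed by every \<open>g\<close> disjoint from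
  \<open>m \<times> 2 \<union> \<omega> \<times> {i}\<close>. This smallness condition is inherited by subsets, power sets and definable images.
  For each \<open>i\<close> the set of all nodes \<open>(k, 0, p)\<close> with \<open>k \<in> \<omega> \<times> {i}\<close> is small, but the union of
  these two sets is not.
\<close>

section \<open>Semantics of first-order formulas\<close>

text \<open>A well-founded extensional structure is rigid, so flips can act nontrivially only if
  \<open>E\<close> descends forever somewhere. Foundation constrains sets alone, and smallness is
  tuned to keep unbounded descents from being collected: each step to a child adds points of both
  colours to the area, so a node of level above \<open>m\<close> has \<open>pr m j\<close> in its
  area for both bits \<open>j\<close>, while a support \<open>un (L m) (col i)\<close> covers only
  \<open>j = i\<close>. So a support contains one column only, and supports of different colours
  have no common bound; Foundation and binary union are played against each other.

  The ground model is an arbitrary model of ZF: it may be ill-founded from outside and need not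
  satisfy choice. Hence induction, Separation and Replacement inside it are available only for
  predicates given by formulas, definability is tracked throughout, and every witness collected by
  Replacement has to be unique.\<close>

lemma case_nat_Suc_eta: "case_nat (s 0) (\<lambda>n. s (Suc n)) = s"
  by (auto split: nat.split)

lemma range_case_nat: "a \<in> M \<Longrightarrow> range s \<subseteq> M \<Longrightarrow> range (case_nat a s) \<subseteq> M"
  by (auto simp: image_subset_iff split: nat.split)

lemma sat_cong_fv:
  "(\<And>k. k \<in> fv p \<Longrightarrow> s k = t k) \<Longrightarrow> sat M E s p \<longleftrightarrow> sat M E t p"
proof (induction p arbitrary: s t)
  case (Imp p q)
  have "sat M E s p \<longleftrightarrow> sat M E t p" "sat M E s q \<longleftrightarrow> sat M E t q"
    by (rule Imp.IH; use Imp.prems in simp)+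
  then show ?case by simp
next
  case (All p)
  have "sat M E (case_nat a s) p \<longleftrightarrow> sat M E (case_nat a t) p" for a
    by (rule All.IH) (use All.prems in \<open>auto split: nat.split\<close>)
  then show ?case by simp
qed auto

lemma finite_fv: "finite (fv p)"
proof (induction p)
  case (All p)
  then have "finite (Suc -` fv p)" by (intro finite_vimageI) auto
  then show ?case by (simp add: vimage_def)
qed auto

lemma fv_bounded: "\<exists>n. \<forall>k\<in>fv p. k < n"
  using finite_nat_set_iff_bounded[of "fv p"] finite_fv by auto

lemma fv_All_funpow: "fv ((All ^^ n) p) = {k. k + n \<in> fv p}"
  by (induction n) auto

text \<open>The theory contains a schema instance only through sentences
  \<open>(All ^^ n) p\<close>; their validity says something about \<open>p\<close> only if some
  number of quantifiers closes it.\<close>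

lemma ex_closure: "\<exists>n. (All ^^ n) p \<in> closures p"
proof -
  obtain n where "\<forall>k\<in>fv p. k < n" using fv_bounded by blast
  then have "fv ((All ^^ n) p) = {}" unfolding fv_All_funpow by force
  then show ?thesis unfolding closures_def by blast
qed

lemma valid_All:
  "(\<forall>s. range s \<subseteq> M \<longrightarrow> sat M E s (All q)) \<longleftrightarrow> (\<forall>s. range s \<subseteq> M \<longrightarrow> sat M E s q)"
proof (intro iffI allI impI)
  fix s :: "nat \<Rightarrow> 'a" assume *: "\<forall>s. range s \<subseteq> M \<longrightarrow> sat M E s (All q)" and s: "range s \<subseteq> M"
  have "range (\<lambda>n. s (Suc n)) \<subseteq> M" "s 0 \<in> M" using s by auto
  then have "sat M E (case_nat (s 0) (\<lambda>n. s (Suc n))) q" using *[rule_format] by simp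
  then show "sat M E s q" by (simp only: case_nat_Suc_eta)
next
  fix s :: "nat \<Rightarrow> 'a" assume *: "\<forall>s. range s \<subseteq> M \<longrightarrow> sat M E s q" and s: "range s \<subseteq> M"
  show "sat M E s (All q)" using *[rule_format, OF range_case_nat[OF _ s]] by simp
qed

lemma valid_All_funpow:
  "(\<forall>s. range s \<subseteq> M \<longrightarrow> sat M E s ((All ^^ n) p)) \<longleftrightarrow> (\<forall>s. range s \<subseteq> M \<longrightarrow> sat M E s p)"
proof (induction n)
  case (Suc n)
  have "(All ^^ Suc n) p = All ((All ^^ n) p)" by simp
  then show ?case by (simp only: valid_All Suc)
qed simp

lemma valid_closures:
  "(\<forall>q\<in>closures p. \<forall>s. range s \<subseteq> M \<longrightarrow> sat M E s q) \<longleftrightarrow> (\<forall>s. range s \<subseteq> M \<longrightarrow> sat M E s p)"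
proof -
  have "(\<forall>s. range s \<subseteq> M \<longrightarrow> sat M E s q) \<longleftrightarrow> (\<forall>s. range s \<subseteq> M \<longrightarrow> sat M E s p)"
    if "q \<in> closures p" for q
    using that valid_All_funpow[of M E _ p] unfolding closures_def by auto
  moreover obtain q where "q \<in> closures p" using ex_closure by blast
  ultimately show ?thesis by (simp only: cong: ball_cong) auto
qed

text \<open>With this form the schemas are used and verified with free parameters, under arbitrary
  assignments, instead of through their closures.\<close>

lemma is_model_ZF_minus_Union_iff:
  "is_model M E ZF_minus_Union \<longleftrightarrow> M \<noteq> {} \<and>
     ((\<forall>p\<in>{Extensionality, Foundation, Pairing, Power_Set, Infinity}.
        \<forall>s. range s \<subseteq> M \<longrightarrow> sat M E s p) \<and>
     (\<forall>p. \<forall>s. range s \<subseteq> M \<longrightarrow> sat M E s (Comprehension_body p))) \<and>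
     (\<forall>p s. range s \<subseteq> M \<longrightarrow> sat M E s (Replacement_body p))"
proof -
  have *: "(\<forall>q\<in>(\<Union>p. closures (f p)). Q q) \<longleftrightarrow> (\<forall>p. \<forall>q\<in>closures (f p). Q q)" for f Q
    by blast
  show ?thesis unfolding is_model_def ZF_minus_Union_def ball_Un * valid_closures by (rule refl)
qed

section \<open>Soundness and transport along isomorphisms\<close>

lemma soundness:
  assumes "G \<turnstile> p" "range s \<subseteq> M" "\<forall>q\<in>G. sat M E s q"
  shows "sat M E s p"
  using assms
proof (induction arbitrary: s rule: proves.induct)
  case (AllI G p)
  have "sat M E (case_nat a s) p" if "a \<in> M" for a
  proof (rule AllI.IH)
    show "range (case_nat a s) \<subseteq> M" using that AllI.prems(1) by (rule range_case_nat)
    show "\<forall>q\<in>lift ` G. sat M E (case_nat a s) q"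
      using AllI.prems by (auto simp: lift_def sat_rename)
  qed
  then show ?case by simp
next
  case (AllE G p x)
  have "(\<lambda>k. s (case_nat x (\<lambda>k. k) k)) = case_nat (s x) s" by (auto split: nat.split)
  moreover have "s x \<in> M" using AllE.prems by auto
  ultimately show ?case using AllE.IH[OF AllE.prems] by (simp add: inst_def sat_rename)
next
  case (EqSubst G x y p)
  have "(\<lambda>k. s (case_nat x (\<lambda>k. k) k)) = case_nat (s x) s" for x by (auto split: nat.split)
  then show ?case using EqSubst.IH[OF EqSubst.prems] by (simp add: inst_def sat_rename)
next
  case (ImpI p G q)
  then show ?case by simp
next
  case (ImpE G p q)
  show ?case using ImpE.IH[OF ImpE.prems] by simp
next
  case (Contr p G)
  show ?case
  proof (rule ccontr)
    assume "\<not> sat M E s p"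
    then show False using Contr.IH[OF Contr.prems(1)] Contr.prems(2) by simp
  qed
qed auto

lemma not_proves_if_model:
  assumes "is_model M E T" "range s \<subseteq> M" "\<not> sat M E s p"
  shows "\<not> T \<turnstile> p"
  using soundness[of T p s M E] assms unfolding is_model_def by blast

text \<open>Serves two purposes: moving models between carriers, and, with a flip as
  \<open>f\<close>, the invariance of truth under automorphisms.\<close>

lemma sat_image_iso:
  assumes "\<And>x y. x \<in> M \<Longrightarrow> y \<in> M \<Longrightarrow> E' (f x) (f y) \<longleftrightarrow> E x y" "inj_on f M" "range s \<subseteq> M"
  shows "sat (f ` M) E' (\<lambda>k. f (s k)) p \<longleftrightarrow> sat M E s p"
  using assms(3)
proof (induction p arbitrary: s)
  case (Mem x y)
  then have "s x \<in> M" "s y \<in> M" by auto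
  then show ?case using assms(1) by simp
next
  case (Eq x y)
  then have "s x \<in> M" "s y \<in> M" by auto
  then show ?case using assms(2) by (auto simp: inj_on_def)
next
  case (All p)
  have "sat (f ` M) E' (case_nat (f a) (\<lambda>k. f (s k))) p \<longleftrightarrow> sat M E (case_nat a s) p"
    if "a \<in> M" for a
  proof -
    have "(\<lambda>k. f (case_nat a s k)) = case_nat (f a) (\<lambda>k. f (s k))" by (auto split: nat.split)
    moreover have "range (case_nat a s) \<subseteq> M" using that All.prems by (rule range_case_nat)
    ultimately show ?thesis using All.IH[of "case_nat a s"] by simp
  qed
  then show ?case by simp
qed auto

lemma is_model_image_iso:
  assumes "\<And>x y. x \<in> M \<Longrightarrow> y \<in> M \<Longrightarrow> E' (f x) (f y) \<longleftrightarrow> E x y" "inj_on f M" "is_model M E T"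
  shows "is_model (f ` M) E' T"
  unfolding is_model_def
proof (intro conjI ballI allI impI)
  show "f ` M \<noteq> {}" using assms(3) by (simp add: is_model_def)
  fix p and s :: "nat \<Rightarrow> _" assume p: "p \<in> T" and s: "range s \<subseteq> f ` M"
  have s': "s = (\<lambda>k. f (inv_into M f (s k)))" "range (\<lambda>k. inv_into M f (s k)) \<subseteq> M"
    using s by (auto simp: f_inv_into_f image_subset_iff inv_into_into)
  have "sat M E (\<lambda>k. inv_into M f (s k)) p" using assms(3) p s'(2) by (auto simp: is_model_def)
  then have "sat (f ` M) E' (\<lambda>k. f (inv_into M f (s k))) p"
    by (subst sat_image_iso[where E = E]) (use assms s'(2) in auto)
  then show "sat (f ` M) E' s p" by (simp only: s'(1)[symmetric])
qed

section \<open>The downward Loewenheim-Skolem theorem\<close>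

instance fm :: countable by countable_datatype

datatype skolem_term = Skolem fm "skolem_term list"

instance skolem_term :: countable by countable_datatype

text \<open>The hull is the range of an evaluation of finite Skolem terms, one function symbol per
  formula, so its countability is that of a datatype.\<close>

lemma countable_elementary_substructure:
  fixes M :: "'a set"
  assumes "M \<noteq> {}"
  obtains H where "H \<subseteq> M" "H \<noteq> {}" "countable H"
    "\<And>s p. range s \<subseteq> H \<Longrightarrow> sat H E s p \<longleftrightarrow> sat M E s p"
proof -
  obtain v0 where v0: "v0 \<in> M" using assms by blast
  define env :: "'a list \<Rightarrow> nat \<Rightarrow> 'a" where "env l k = (if k < length l then l ! k else v0)" for l k
  define wit where "wit p l = (if \<exists>a\<in>M. sat M E (case_nat a (env l)) p
     then SOME a. a \<in> M \<and> sat M E (case_nat a (env l)) p else v0)" for p l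
  have wit: "wit p l \<in> M \<and> sat M E (case_nat (wit p l) (env l)) p"
    if "\<exists>a\<in>M. sat M E (case_nat a (env l)) p" for p l
  proof -
    have "\<exists>a. a \<in> M \<and> sat M E (case_nat a (env l)) p" using that by blast
    then show ?thesis using that someI_ex[of "\<lambda>a. a \<in> M \<and> sat M E (case_nat a (env l)) p"]
      unfolding wit_def by simp
  qed
  have wit_M: "wit p l \<in> M" for p l
    using wit v0 by (cases "\<exists>a\<in>M. sat M E (case_nat a (env l)) p") (auto simp: wit_def)
  define ev where "ev = rec_skolem_term (\<lambda>p ts. wit p (map snd ts))"
  have ev: "ev (Skolem p ts) = wit p (map ev ts)" for p ts
    unfolding ev_def by (simp add: comp_def)
  define H where "H = range ev"
  have HM: "H \<subseteq> M" unfolding H_def using ev wit_M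
    by (auto intro!: image_subsetI) (metis skolem_term.exhaust)
  have "sat H E s p \<longleftrightarrow> sat M E s p" if "range s \<subseteq> H" for s p
    using that
  proof (induction p arbitrary: s)
    case (All p)
    have IH: "sat H E (case_nat a s) p \<longleftrightarrow> sat M E (case_nat a s) p" if "a \<in> H" for a
      by (rule All.IH[OF range_case_nat[OF that All.prems]])
    have "sat M E (case_nat a s) p" if all: "\<forall>a\<in>H. sat M E (case_nat a s) p" and "a \<in> M" for a
    proof (rule ccontr)
      assume neg: "\<not> sat M E (case_nat a s) p"
      obtain n where n: "\<forall>k\<in>fv p. k < n" using fv_bounded by blast
      \<comment> \<open>Only finitely many variables are free in \<open>p\<close>, so a finite list
        of terms can replace the assignment; \<open>env\<close> pads it with
        \<open>v0\<close>.\<close>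
      define ts where "ts = map (\<lambda>k. inv ev (s k)) [0..<n]"
      have ts: "map ev ts = map s [0..<n]"
        unfolding ts_def using All.prems unfolding H_def
        by (auto simp: f_inv_into_f image_subset_iff)
      have cong: "sat M E (case_nat b (env (map ev ts))) p \<longleftrightarrow> sat M E (case_nat b s) p" for b
        by (rule sat_cong_fv) (use n in \<open>auto simp: ts env_def split: nat.split dest!: bspec\<close>)
      \<comment> \<open>A failing universal statement is refuted inside \<open>H\<close> by the
        Skolem term for the negation.\<close>
      have "\<exists>a\<in>M. sat M E (case_nat a (env (map ev ts))) (Neg p)"
        using neg \<open>a \<in> M\<close> cong by auto
      then have "\<not> sat M E (case_nat (ev (Skolem (Neg p) ts)) s) p"
        unfolding ev using wit[of "map ev ts" "Neg p"] cong by simp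
      then show False using all H_def by blast
    qed
    then show ?case using IH HM by auto
  qed auto
  moreover have "countable H" "H \<noteq> {}" unfolding H_def by auto
  ultimately show thesis using that HM by blast
qed

section \<open>Definable predicates in a model of ZF\<close>

named_theorems definable_intros

locale zf =
  fixes mem :: "'a \<Rightarrow> 'a \<Rightarrow> bool" (infix \<open>\<epsilon>\<close> 50)
  assumes model: "is_model UNIV mem ZF"
begin

text \<open>Interleaving leaves infinitely many places for parameters next to infinitely many
  variables, so two parameter sequences can again be merged into one, by \<open>mix\<close>
  itself.\<close>

definition mix :: "(nat \<Rightarrow> 'a) \<Rightarrow> (nat \<Rightarrow> 'a) \<Rightarrow> nat \<Rightarrow> 'a" where
  "mix c s = (\<lambda>k. if even k then s (k div 2) else c (k div 2))"

text \<open>A predicate of an assignment is definable if a formula expresses it; in that formula the even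
  variables read the assignment and the odd ones hold arbitrary parameters.\<close>

definition definable :: "((nat \<Rightarrow> 'a) \<Rightarrow> bool) \<Rightarrow> bool" where
  "definable P \<longleftrightarrow> (\<exists>q c. \<forall>s. P s \<longleftrightarrow> sat UNIV mem (mix c s) q)"

definition definable_term :: "((nat \<Rightarrow> 'a) \<Rightarrow> 'a) \<Rightarrow> bool" where
  "definable_term t \<longleftrightarrow> definable (\<lambda>s. s 0 = t (\<lambda>n. s (Suc n)))"

section \<open>Closure of definability under the logical operations\<close>

lemma definableI:
  assumes "\<And>s. P s \<longleftrightarrow> sat UNIV mem (\<lambda>k. mix c s (f k)) q"
  shows "definable P"
  unfolding definable_def using assms by (auto simp: sat_rename[symmetric])

lemma definable_mem_var: "definable (\<lambda>s. s i \<epsilon> s j)"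
  by (rule definableI[where f = id and q = "Mem (2 * i) (2 * j)"]) (simp add: mix_def)

lemma definable_eq_var: "definable (\<lambda>s. s i = s j)"
  by (rule definableI[where f = id and q = "Eq (2 * i) (2 * j)"]) (simp add: mix_def)

lemma definable_rename:
  assumes "definable P"
  shows "definable (\<lambda>s. P (\<lambda>n. s (f n)))"
proof -
  obtain q c where q: "\<And>s. P s \<longleftrightarrow> sat UNIV mem (mix c s) q" using assms unfolding definable_def by blast
  have "mix c (\<lambda>n. s (f n)) = (\<lambda>k. mix c s (if even k then 2 * f (k div 2) else k))" for s
    by (rule ext) (simp add: mix_def)
  then show ?thesis
    by (intro definableI[where c = c and f = "\<lambda>k. if even k then 2 * f (k div 2) else k" and q = q])
       (simp add: q)
qed

lemma definable_instantiate:
  assumes "definable P"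
  shows "definable (\<lambda>s. P (\<lambda>k. if b k then s (h k) else d k))"
proof -
  obtain q c where q: "\<And>s. P s \<longleftrightarrow> sat UNIV mem (mix c s) q" using assms unfolding definable_def by blast
  \<comment> \<open>In \<open>mix d c\<close> the old parameters occupy the even places and the
    values of \<open>d\<close> the odd ones.\<close>
  define f where "f k = (if odd k then 2 * (2 * (k div 2)) + 1 else
    if b (k div 2) then 2 * h (k div 2) else 2 * (2 * (k div 2) + 1) + 1)" for k
  have "mix c (\<lambda>k. if b k then s (h k) else d k) = (\<lambda>k. mix (mix d c) s (f k))" for s
    by (rule ext) (auto simp: mix_def f_def elim!: oddE)
  then show ?thesis by (intro definableI[where c = "mix d c" and f = f and q = q]) (simp add: q)
qed

lemma definable_imp:
  assumes "definable P" "definable Q"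
  shows "definable (\<lambda>s. P s \<longrightarrow> Q s)"
proof -
  obtain p c where p: "\<And>s. P s \<longleftrightarrow> sat UNIV mem (mix c s) p" using assms(1) unfolding definable_def by blast
  obtain q d where q: "\<And>s. Q s \<longleftrightarrow> sat UNIV mem (mix d s) q" using assms(2) unfolding definable_def by blast
  define e where "e = mix d c"
  have 1: "mix c s = (\<lambda>k. mix e s (if even k then k else 2 * (2 * (k div 2)) + 1))"
    and 2: "mix d s = (\<lambda>k. mix e s (if even k then k else 2 * (2 * (k div 2) + 1) + 1))" for s
    by (rule ext, auto simp: mix_def e_def elim!: oddE)+
  show ?thesis
    by (rule definableI[where f = id and c = e and q = "Imp
       (rename (\<lambda>k. if even k then k else 2 * (2 * (k div 2)) + 1) p)
       (rename (\<lambda>k. if even k then k else 2 * (2 * (k div 2) + 1) + 1) q)"])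
      (simp only: p q 1 2 sat.simps sat_rename id_apply)
qed

lemma definable_all:
  assumes "definable (\<lambda>s. Q (\<lambda>n. s (Suc n)) (s 0))"
  shows "definable (\<lambda>s. \<forall>y. Q s y)"
proof -
  obtain q c where q: "\<And>s. Q (\<lambda>n. s (Suc n)) (s 0) \<longleftrightarrow> sat UNIV mem (mix c s) q"
    using assms unfolding definable_def by blast
  \<comment> \<open>Variable 0 becomes the bound variable, the other even variables move down by one
    position, and parameters keep theirs; \<open>Suc\<close> accounts for the new binder.\<close>
  define f where "f k = (if even k then if k = 0 then 0 else Suc (2 * (k div 2 - 1)) else Suc k)" for k :: nat
  have "mix c (case_nat y s) k = case_nat y (mix c s) (f k)" for y s k
    by (auto simp: mix_def f_def elim!: evenE oddE split: nat.split)
  then have *: "mix c (case_nat y s) = (\<lambda>k. case_nat y (mix c s) (f k))" for y s by blast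
  have "Q s y \<longleftrightarrow> sat UNIV mem (mix c (case_nat y s)) q" for s y using q[of "case_nat y s"] by simp
  then show ?thesis
    by (intro definableI[where f = id and c = c and q = "All (rename f q)"]) (simp add: sat_rename *)
qed

lemma definable_False: "definable (\<lambda>s. False)"
  by (rule definableI[where f = id and q = Fls]) simp

lemma definable_not: "definable P \<Longrightarrow> definable (\<lambda>s. \<not> P s)"
  using definable_imp[OF _ definable_False] by simp

lemma definable_disj: "definable P \<Longrightarrow> definable Q \<Longrightarrow> definable (\<lambda>s. P s \<or> Q s)"
  using definable_imp[OF definable_not] by (simp add: disj_imp)

lemma definable_conj: "definable P \<Longrightarrow> definable Q \<Longrightarrow> definable (\<lambda>s. P s \<and> Q s)"
  using definable_not[OF definable_imp[OF _ definable_not]] by simp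

lemma definable_iff: "definable P \<Longrightarrow> definable Q \<Longrightarrow> definable (\<lambda>s. P s \<longleftrightarrow> Q s)"
  unfolding iff_conv_conj_imp by (intro definable_conj definable_imp)

lemma definable_ex:
  assumes "definable (\<lambda>s. Q (\<lambda>n. s (Suc n)) (s 0))"
  shows "definable (\<lambda>s. \<exists>y. Q s y)"
  using definable_not[OF definable_all[OF definable_not[OF assms]]] by simp

section \<open>Definable terms and substitution\<close>

lemma definable_term_var: "definable_term (\<lambda>s. s i)"
  unfolding definable_term_def by (rule definable_eq_var)

lemma definable_term_const: "definable_term (\<lambda>s. x)"
  unfolding definable_term_def
  by (rule definableI[where f = id and c = "\<lambda>_. x" and q = "Eq 0 1"]) (simp add: mix_def)

text \<open>The language has no terms besides variables, so a definable term is substituted by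
  quantifying over its value.\<close>

lemma definable_subst1:
  assumes "definable (\<lambda>s. R (s 0))" "definable_term a"
  shows "definable (\<lambda>s. R (a s))"
proof -
  have "definable (\<lambda>s. \<exists>x. x = a s \<and> R x)"
    by (intro definable_ex definable_conj assms assms(2)[unfolded definable_term_def])
  then show ?thesis by simp
qed

lemma definable_subst2:
  assumes "definable (\<lambda>s. R (s 0) (s (Suc 0)))" "definable_term a" "definable_term b"
  shows "definable (\<lambda>s. R (a s) (b s))"
proof -
  have "definable (\<lambda>s. \<exists>y. y = b s \<and> (\<exists>x. x = a s \<and> R x y))"
    using definable_rename[OF assms(2)[unfolded definable_term_def], of "case_nat 0 (\<lambda>n. Suc (Suc n))"]
    by (intro definable_ex definable_conj assms(1) assms(3)[unfolded definable_term_def]) simp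
  then show ?thesis by simp
qed

lemma definable_subst3:
  assumes "definable (\<lambda>s. R (s 0) (s (Suc 0)) (s (Suc (Suc 0))))"
    "definable_term a" "definable_term b" "definable_term c"
  shows "definable (\<lambda>s. R (a s) (b s) (c s))"
proof -
  have "definable (\<lambda>s. \<exists>z. z = c s \<and> (\<exists>y. y = b s \<and> (\<exists>x. x = a s \<and> R x y z)))"
    using definable_rename[OF assms(2)[unfolded definable_term_def], of "case_nat 0 (\<lambda>n. Suc (Suc (Suc n)))"]
      definable_rename[OF assms(3)[unfolded definable_term_def], of "case_nat 0 (\<lambda>n. Suc (Suc n))"]
    by (intro definable_ex definable_conj assms(1) assms(4)[unfolded definable_term_def]) simp_all
  then show ?thesis by simp
qed

lemma definable_term_subst1:
  assumes "definable_term (\<lambda>s. f (s 0))" "definable_term a"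
  shows "definable_term (\<lambda>s. f (a s))"
proof -
  have "definable (\<lambda>s. \<exists>x. x = a (\<lambda>n. s (Suc n)) \<and> s 0 = f x)"
    using definable_rename[OF assms(1)[unfolded definable_term_def], of "case_nat 1 (case_nat 0 (\<lambda>n. n))"]
      definable_rename[OF assms(2)[unfolded definable_term_def], of "case_nat 0 (\<lambda>n. Suc (Suc n))"]
    by (intro definable_ex definable_conj) simp_all
  then show ?thesis by (simp add: definable_term_def)
qed

lemma definable_term_subst2:
  assumes "definable_term (\<lambda>s. f (s 0) (s (Suc 0)))" "definable_term a" "definable_term b"
  shows "definable_term (\<lambda>s. f (a s) (b s))"
proof -
  have "definable (\<lambda>s. \<exists>y. y = b (\<lambda>n. s (Suc n)) \<and> (\<exists>x. x = a (\<lambda>n. s (Suc n)) \<and> s 0 = f x y))"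
    using definable_rename[OF assms(1)[unfolded definable_term_def],
        of "case_nat 2 (case_nat 0 (case_nat 1 (\<lambda>n. n)))"]
      definable_rename[OF assms(2)[unfolded definable_term_def], of "case_nat 0 (\<lambda>n. Suc (Suc (Suc n)))"]
      definable_rename[OF assms(3)[unfolded definable_term_def], of "case_nat 0 (\<lambda>n. Suc (Suc n))"]
    by (intro definable_ex definable_conj) (simp_all add: numeral_2_eq_2)
  then show ?thesis by (simp add: definable_term_def)
qed

lemmas definable_mem = definable_subst2[where R = "(\<epsilon>)", OF definable_mem_var]
lemmas definable_eq = definable_subst2[where R = "(=)", OF definable_eq_var]

lemmas [definable_intros] = definable_mem definable_eq definable_imp definable_not definable_disj
  definable_conj definable_iff definable_all definable_ex definable_False
  definable_term_var definable_term_const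

section \<open>Set theory inside the model\<close>

lemma sat_ZF: "p \<in> ZF \<Longrightarrow> sat UNIV mem s p"
  using model unfolding is_model_def by simp

lemma model_ZF_minus_Union: "is_model UNIV mem ZF_minus_Union"
  using model unfolding is_model_def ZF_def by blast

lemma extensionality: "(\<And>z. z \<epsilon> x \<longleftrightarrow> z \<epsilon> y) \<Longrightarrow> x = y"
  using sat_ZF[of Extensionality] unfolding sat_Extensionality
  by (simp add: ZF_def ZF_minus_Union_def)

lemma foundation: "y \<epsilon> x \<Longrightarrow> \<exists>y. y \<epsilon> x \<and> (\<forall>z. z \<epsilon> x \<longrightarrow> \<not> z \<epsilon> y)"
  using sat_ZF[of Foundation] unfolding sat_Foundation
  by (simp add: ZF_def ZF_minus_Union_def) blast

definition is_set :: "('a \<Rightarrow> bool) \<Rightarrow> bool" where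
  "is_set P \<longleftrightarrow> (\<exists>b. \<forall>x. x \<epsilon> b \<longleftrightarrow> P x)"

definition coll :: "('a \<Rightarrow> bool) \<Rightarrow> 'a" where
  "coll P = (THE b. \<forall>x. x \<epsilon> b \<longleftrightarrow> P x)"

lemma mem_coll: assumes "is_set P" shows "x \<epsilon> coll P \<longleftrightarrow> P x"
proof -
  obtain b where b: "\<forall>x. x \<epsilon> b \<longleftrightarrow> P x" using assms unfolding is_set_def by blast
  have "coll P = b" unfolding coll_def
    by (rule the_equality) (use b in \<open>auto intro: extensionality\<close>)
  then show ?thesis using b by blast
qed

lemma eq_coll_iff: "is_set P \<Longrightarrow> b = coll P \<longleftrightarrow> (\<forall>x. x \<epsilon> b \<longleftrightarrow> P x)"
  using mem_coll extensionality by metis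

lemma definable_term_coll:
  assumes "\<And>s. is_set (P s)" "definable (\<lambda>s. P (\<lambda>n. s (Suc n)) (s 0))"
  shows "definable_term (\<lambda>s. coll (P s))"
proof -
  have "definable (\<lambda>s. P (\<lambda>n. s (case_nat 0 (\<lambda>n. Suc (Suc n)) (Suc n))) (s (case_nat 0 (\<lambda>n. Suc (Suc n)) 0)))"
    by (rule definable_rename[OF assms(2)])
  then have "definable (\<lambda>s. P (\<lambda>n. s (Suc (Suc n))) (s 0))" by simp
  then show ?thesis
    unfolding definable_term_def eq_coll_iff[OF assms(1)] by (intro definable_intros)
qed

lemma is_set_separation:
  assumes "definable (\<lambda>s. P (s 0))"
  shows "is_set (\<lambda>x. x \<epsilon> a \<and> P x)"
proof -
  obtain q c where q: "\<And>s. P (s 0) \<longleftrightarrow> sat UNIV mem (mix c s) q" using assms unfolding definable_def by blast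
  \<comment> \<open>Index 0 stays with the element; all others jump over index 1, which the schema
    reserves for the given set.\<close>
  define f where "f k = (if k = 0 then 0 else Suc (Suc k))" for k :: nat
  have "sat UNIV mem (mix c (\<lambda>_. a)) (Comprehension_body (rename f q))"
    using model_ZF_minus_Union unfolding is_model_ZF_minus_Union_iff by simp
  note bspec[OF this[unfolded sat_Comprehension_body] UNIV_I, of a]
  moreover have "sat UNIV mem (case_nat x (case_nat a (mix c (\<lambda>_. a)))) (rename f q) \<longleftrightarrow> P x" for x
  proof -
    have "(\<lambda>k. case_nat x (case_nat a (mix c (\<lambda>_. a))) (f k)) = mix c (case_nat x (\<lambda>_. a))"
      by (rule ext) (auto simp: f_def mix_def elim!: evenE split: nat.split)
    then show ?thesis using q[of "case_nat x (\<lambda>_. a)"] by (simp add: sat_rename)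
  qed
  ultimately show ?thesis unfolding is_set_def by simp
qed

lemma is_set_subset:
  assumes "is_set Q" "\<And>x. P x \<Longrightarrow> Q x" "definable (\<lambda>s. P (s 0))"
  shows "is_set P"
proof -
  have "(\<lambda>x. x \<epsilon> coll Q \<and> P x) = P" using assms(1,2) by (auto simp: mem_coll)
  then show ?thesis using is_set_separation[OF assms(3), of "coll Q"] by simp
qed

lemma is_set_replacement:
  assumes "definable (\<lambda>s. R (s 0) (s (Suc 0)))"
    and "\<And>x y z. x \<epsilon> a \<Longrightarrow> R x y \<Longrightarrow> R x z \<Longrightarrow> y = z"
  shows "is_set (\<lambda>y. \<exists>x. x \<epsilon> a \<and> R x y)"
proof -
  obtain q c where q: "\<And>s. R (s 0) (s (Suc 0)) \<longleftrightarrow> sat UNIV mem (mix c s) q"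
    using assms(1) unfolding definable_def by blast
  \<comment> \<open>In \<open>q\<close> the argument is variable 0 and the value variable 2, odd
    places being parameters; the schema has the value at 0, the argument at 1 and the given set at
    2.\<close>
  define f where "f k = (if k = 0 then 1 else if k = 2 then 0 else Suc (Suc (Suc k)))" for k :: nat
  have "sat UNIV mem (mix c (\<lambda>_. a)) (Replacement_body (rename f q))"
    using model_ZF_minus_Union unfolding is_model_ZF_minus_Union_iff by simp
  note bspec[OF this[unfolded sat_Replacement_body] UNIV_I, of a]
  moreover have "sat UNIV mem (case_nat y (case_nat x (case_nat a (mix c (\<lambda>_. a))))) (rename f q) \<longleftrightarrow> R x y" for x y
  proof -
    have "(\<lambda>k. case_nat y (case_nat x (case_nat a (mix c (\<lambda>_. a)))) (f k)) = mix c (case_nat x (case_nat y (\<lambda>_. a)))"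
      by (rule ext) (auto simp: f_def mix_def elim!: evenE split: nat.split)
    then show ?thesis using q[of "case_nat x (case_nat y (\<lambda>_. a))"] by (simp add: sat_rename)
  qed
  ultimately have "(\<forall>x. x \<epsilon> a \<longrightarrow> (\<forall>y z. R x y \<and> R x z \<longrightarrow> y = z)) \<longrightarrow>
      (\<exists>b. \<forall>y. y \<epsilon> b \<longleftrightarrow> (\<exists>x. x \<epsilon> a \<and> R x y))"
    by simp
  then show ?thesis unfolding is_set_def using assms(2) by meson
qed

lemma is_set_mem: "is_set (\<lambda>x. x \<epsilon> a)" unfolding is_set_def by blast

lemma is_set_upair: "is_set (\<lambda>x. x = a \<or> x = b)"
  using sat_ZF[of Pairing] unfolding sat_Pairing is_set_def
  by (simp add: ZF_def ZF_minus_Union_def)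

lemma is_set_Union: "is_set (\<lambda>x. \<exists>y. y \<epsilon> a \<and> x \<epsilon> y)"
  using sat_ZF[of Defs.Union] unfolding sat_Union is_set_def
  by (simp add: ZF_def ZF_minus_Union_def)

lemma is_set_Pow: "is_set (\<lambda>x. \<forall>z. z \<epsilon> x \<longrightarrow> z \<epsilon> a)"
  using sat_ZF[of Power_Set] unfolding sat_Power_Set is_set_def
  by (simp add: ZF_def ZF_minus_Union_def)

lemma is_set_image:
  assumes "definable_term (\<lambda>s. f (s 0))"
  shows "is_set (\<lambda>y. \<exists>x. x \<epsilon> a \<and> y = f x)"
  by (rule is_set_replacement) (auto intro!: definable_intros definable_term_subst1[OF assms])

lemma is_set_empty: "is_set (\<lambda>x. False)"
  using is_set_separation[OF definable_False] by simp

section \<open>Elementary set operations and ordered pairs\<close>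

definition emp where "emp = coll (\<lambda>x. False)"
definition upair where "upair a b = coll (\<lambda>x. x = a \<or> x = b)"
definition un where "un a b = coll (\<lambda>x. x \<epsilon> a \<or> x \<epsilon> b)"
definition inter where "inter a b = coll (\<lambda>x. x \<epsilon> a \<and> x \<epsilon> b)"
definition symdiff where "symdiff a b = coll (\<lambda>x. (x \<epsilon> a) \<noteq> (x \<epsilon> b))"
definition pow where "pow a = coll (\<lambda>x. \<forall>z. z \<epsilon> x \<longrightarrow> z \<epsilon> a)"
definition bigun where "bigun a = coll (\<lambda>x. \<exists>y. y \<epsilon> a \<and> x \<epsilon> y)"
definition sub (infix \<open>\<sqsubseteq>\<close> 50) where "sub a b \<longleftrightarrow> (\<forall>x. x \<epsilon> a \<longrightarrow> x \<epsilon> b)"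

lemma mem_emp [simp]: "\<not> x \<epsilon> emp" unfolding emp_def by (simp add: mem_coll is_set_empty)
lemma mem_upair [simp]: "x \<epsilon> upair a b \<longleftrightarrow> x = a \<or> x = b"
  unfolding upair_def by (simp add: mem_coll is_set_upair)
lemma is_set_un: "is_set (\<lambda>x. x \<epsilon> a \<or> x \<epsilon> b)"
  using is_set_Union[of "upair a b"] by (simp add: conj_disj_distribR ex_disj_distrib)
lemma mem_un [simp]: "x \<epsilon> un a b \<longleftrightarrow> x \<epsilon> a \<or> x \<epsilon> b"
  unfolding un_def by (simp add: mem_coll is_set_un)
lemma is_set_inter: "is_set (\<lambda>x. x \<epsilon> a \<and> x \<epsilon> b)"
  by (rule is_set_separation) (intro definable_intros)
lemma mem_inter [simp]: "x \<epsilon> inter a b \<longleftrightarrow> x \<epsilon> a \<and> x \<epsilon> b"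
  unfolding inter_def by (simp add: mem_coll is_set_inter)
lemma is_set_symdiff: "is_set (\<lambda>x. (x \<epsilon> a) \<noteq> (x \<epsilon> b))"
  by (rule is_set_subset[OF is_set_un[of a b]]) (auto intro!: definable_intros)
lemma mem_symdiff [simp]: "x \<epsilon> symdiff a b \<longleftrightarrow> (x \<epsilon> a) \<noteq> (x \<epsilon> b)"
  unfolding symdiff_def by (rule mem_coll[OF is_set_symdiff])
lemma mem_pow [simp]: "x \<epsilon> pow a \<longleftrightarrow> x \<sqsubseteq> a"
  unfolding pow_def sub_def by (simp add: mem_coll is_set_Pow)
lemma mem_bigun [simp]: "x \<epsilon> bigun a \<longleftrightarrow> (\<exists>y. y \<epsilon> a \<and> x \<epsilon> y)"
  unfolding bigun_def by (simp add: mem_coll is_set_Union)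

lemma is_set_disj: assumes "is_set P" "is_set Q" shows "is_set (\<lambda>x. P x \<or> Q x)"
  using is_set_un[of "coll P" "coll Q"] assms by (simp add: mem_coll)

lemma not_mem_self: "\<not> x \<epsilon> x"
  using foundation[of x "upair x x"] by auto

lemma emp_iff: "x = emp \<longleftrightarrow> (\<forall>y. \<not> y \<epsilon> x)"
  using extensionality[of x emp] by auto

lemma definable_term_upair0: "definable_term (\<lambda>s. upair (s 0) (s (Suc 0)))"
  unfolding upair_def by (intro definable_term_coll is_set_upair definable_intros)
lemma definable_term_un0: "definable_term (\<lambda>s. un (s 0) (s (Suc 0)))"
  unfolding un_def by (intro definable_term_coll is_set_un definable_intros)
lemma definable_term_inter0: "definable_term (\<lambda>s. inter (s 0) (s (Suc 0)))"
  unfolding inter_def by (intro definable_term_coll is_set_inter definable_intros)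
lemma definable_term_symdiff0: "definable_term (\<lambda>s. symdiff (s 0) (s (Suc 0)))"
  unfolding symdiff_def by (intro definable_term_coll is_set_symdiff definable_intros)
lemma definable_sub0: "definable (\<lambda>s. s 0 \<sqsubseteq> s (Suc 0))"
  unfolding sub_def by (intro definable_intros)

lemmas [definable_intros] =
  definable_term_subst2[where f = upair, OF definable_term_upair0]
  definable_term_subst2[where f = un, OF definable_term_un0]
  definable_term_subst2[where f = inter, OF definable_term_inter0]
  definable_term_subst2[where f = symdiff, OF definable_term_symdiff0]
  definable_subst2[where R = sub, OF definable_sub0]

definition pr where "pr a b = upair (upair a a) (upair a b)"
definition succ where "succ a = un a (upair a a)"
definition ins where "ins k a = un (upair k k) a"

lemma mem_succ [simp]: "x \<epsilon> succ a \<longleftrightarrow> x \<epsilon> a \<or> x = a" by (simp add: succ_def)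
lemma mem_ins [simp]: "x \<epsilon> ins k a \<longleftrightarrow> x = k \<or> x \<epsilon> a" by (simp add: ins_def)

lemma upair_inject: "upair a b = upair c d \<longleftrightarrow> a = c \<and> b = d \<or> a = d \<and> b = c"
proof
  show "upair a b = upair c d \<Longrightarrow> a = c \<and> b = d \<or> a = d \<and> b = c"
    using mem_upair[of _ a b] mem_upair[of _ c d] by metis
qed (auto intro: extensionality)

lemma pr_inject [simp]: "pr a b = pr c d \<longleftrightarrow> a = c \<and> b = d"
  unfolding pr_def upair_inject by metis

lemma emp_not_mem_pr [simp]: "\<not> emp \<epsilon> pr a b"
  unfolding pr_def by (simp add: emp_iff) (metis mem_upair mem_emp)

lemma definable_term_pr [definable_intros]: "definable_term a \<Longrightarrow> definable_term b \<Longrightarrow> definable_term (\<lambda>s. pr (a s) (b s))"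
  unfolding pr_def by (intro definable_intros)
lemma definable_term_succ [definable_intros]: "definable_term a \<Longrightarrow> definable_term (\<lambda>s. succ (a s))"
  unfolding succ_def by (intro definable_intros)
lemma definable_term_ins [definable_intros]: "definable_term a \<Longrightarrow> definable_term b \<Longrightarrow> definable_term (\<lambda>s. ins (a s) (b s))"
  unfolding ins_def by (intro definable_intros)

subsection \<open>Natural numbers\<close>

definition omega_closed where
  "omega_closed I \<longleftrightarrow> emp \<epsilon> I \<and> (\<forall>x. x \<epsilon> I \<longrightarrow> succ x \<epsilon> I)"

lemma ex_omega_closed: "\<exists>I. omega_closed I"
proof -
  obtain I z where I: "z \<epsilon> I" "\<forall>w. \<not> w \<epsilon> z"
    "\<forall>y. y \<epsilon> I \<longrightarrow> (\<exists>z. z \<epsilon> I \<and> (\<forall>w. w \<epsilon> z \<longleftrightarrow> w \<epsilon> y \<or> w = y))"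
    using sat_ZF[of Infinity] unfolding sat_Infinity by (auto simp: ZF_def ZF_minus_Union_def)
  have "z = emp" using I(2) emp_iff by blast
  moreover have "\<forall>y. y \<epsilon> I \<longrightarrow> succ y \<epsilon> I"
  proof (intro allI impI)
    fix y assume "y \<epsilon> I"
    then obtain z where "z \<epsilon> I" "\<forall>w. w \<epsilon> z \<longleftrightarrow> w \<epsilon> y \<or> w = y" using I(3) by blast
    moreover from this have "z = succ y" by (intro extensionality) simp
    ultimately show "succ y \<epsilon> I" by simp
  qed
  ultimately show ?thesis using I(1) unfolding omega_closed_def by blast
qed

lemma is_set_omega: "is_set (\<lambda>n. \<forall>I. omega_closed I \<longrightarrow> n \<epsilon> I)"
proof -
  obtain I where "omega_closed I" using ex_omega_closed by blast
  then show ?thesis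
    by (intro is_set_subset[OF is_set_mem[of I]])
      (auto simp: omega_closed_def intro!: definable_intros)
qed

definition omega where "omega = coll (\<lambda>n. \<forall>I. omega_closed I \<longrightarrow> n \<epsilon> I)"

lemma mem_omega: "n \<epsilon> omega \<longleftrightarrow> (\<forall>I. omega_closed I \<longrightarrow> n \<epsilon> I)"
  unfolding omega_def by (rule mem_coll[OF is_set_omega])

lemma emp_omega [simp]: "emp \<epsilon> omega"
  unfolding mem_omega omega_closed_def by blast

lemma succ_omega [simp]: "n \<epsilon> omega \<Longrightarrow> succ n \<epsilon> omega"
  unfolding mem_omega omega_closed_def by blast

text \<open>Seen from outside, \<open>omega\<close> may be nonstandard. A definable predicate cuts
  out a set, and only for sets does minimality of \<open>omega\<close> say anything.\<close>

lemma omega_induct [consumes 1, case_names definable emp succ]: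
  assumes "n \<epsilon> omega" "definable (\<lambda>s. P (s 0))" "P emp"
    "\<And>n. n \<epsilon> omega \<Longrightarrow> P n \<Longrightarrow> P (succ n)"
  shows "P n"
proof -
  have *: "x \<epsilon> coll (\<lambda>x. x \<epsilon> omega \<and> P x) \<longleftrightarrow> x \<epsilon> omega \<and> P x" for x
    by (rule mem_coll[OF is_set_separation[OF assms(2)]])
  have "omega_closed (coll (\<lambda>x. x \<epsilon> omega \<and> P x))"
    unfolding omega_closed_def * using assms(3,4) by simp
  then have "n \<epsilon> coll (\<lambda>x. x \<epsilon> omega \<and> P x)"
    using assms(1) mem_omega by blast
  then show ?thesis using * by simp
qed

lemma omega_transitive: "n \<epsilon> omega \<Longrightarrow> k \<epsilon> n \<Longrightarrow> k \<epsilon> omega \<and> k \<sqsubseteq> n"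
proof (induction n arbitrary: k rule: omega_induct)
  case definable
  show ?case
    by (intro definable_intros)
qed (auto simp: sub_def)

lemma emp_mem_succ: "n \<epsilon> omega \<Longrightarrow> emp \<epsilon> succ n"
proof (induction n rule: omega_induct)
  case definable
  show ?case by (intro definable_intros)
qed auto

lemma succ_mem_succ: "n \<epsilon> omega \<Longrightarrow> k \<epsilon> n \<Longrightarrow> succ k \<epsilon> succ n"
proof (induction n arbitrary: k rule: omega_induct)
  case definable
  show ?case by (intro definable_intros)
qed auto

lemma omega_trichotomy: "m \<epsilon> omega \<Longrightarrow> n \<epsilon> omega \<Longrightarrow> m \<epsilon> n \<or> m = n \<or> n \<epsilon> m"
proof (induction m rule: omega_induct)
  case definable
  show ?case by (intro definable_intros)
next
  case emp
  show ?case using emp by (induction n rule: omega_induct) (auto intro!: definable_intros)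
next
  case (succ m)
  then show ?case using succ_mem_succ[of n m] by auto
qed

lemma omega_linear: "m \<epsilon> omega \<Longrightarrow> n \<epsilon> omega \<Longrightarrow> m \<sqsubseteq> n \<or> n \<sqsubseteq> m"
  using omega_trichotomy[of m n] omega_transitive[of n m] omega_transitive[of m n]
  by (auto simp: sub_def)

text \<open>If \<open>m\<close> and \<open>n\<close> differed, each would be an element of the
  other, and transitivity of \<open>m\<close> would give \<open>m \<epsilon> m\<close>.\<close>

lemma succ_inject: "m \<epsilon> omega \<Longrightarrow> succ m = succ n \<Longrightarrow> m = n"
  using mem_succ[of m n] mem_succ[of n m] mem_succ[of m m] mem_succ[of n n] omega_transitive[of m n]
    not_mem_self[of m]
  by (auto simp: sub_def)

section \<open>Nodes and their flips\<close>

definition one where "one = succ emp"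
definition bit where "bit i \<longleftrightarrow> i = emp \<or> i = one"
definition L where "L m = coll (\<lambda>x. \<exists>j. j \<epsilon> m \<and> (x = pr j emp \<or> x = pr j one))"
definition col where "col i = coll (\<lambda>x. \<exists>j. j \<epsilon> omega \<and> x = pr j i)"

lemma emp_neq_one [simp]: "emp \<noteq> one" "one \<noteq> emp"
  unfolding one_def by (metis mem_emp mem_succ)+

lemma is_set_L: "is_set (\<lambda>x. \<exists>j. j \<epsilon> m \<and> (x = pr j emp \<or> x = pr j one))"
  using is_set_disj[OF is_set_image[where f = "\<lambda>j. pr j emp" and a = m]
      is_set_image[where f = "\<lambda>j. pr j one" and a = m]]
  by (simp add: conj_disj_distribL ex_disj_distrib definable_intros)

lemma mem_L: "x \<epsilon> L m \<longleftrightarrow> (\<exists>j i. j \<epsilon> m \<and> bit i \<and> x = pr j i)"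
  unfolding L_def mem_coll[OF is_set_L] bit_def by blast

lemma mem_col: "x \<epsilon> col i \<longleftrightarrow> (\<exists>j. j \<epsilon> omega \<and> x = pr j i)"
  unfolding col_def by (rule mem_coll[OF is_set_image]) (intro definable_intros)

lemma L_mono: "m \<sqsubseteq> n \<Longrightarrow> L m \<sqsubseteq> L n"
  unfolding sub_def mem_L by blast

lemma definable_bit [definable_intros]: "definable_term a \<Longrightarrow> definable (\<lambda>s. bit (a s))"
  unfolding bit_def by (intro definable_intros)

lemma definable_term_L0: "definable_term (\<lambda>s. L (s 0))"
  unfolding L_def by (intro definable_term_coll is_set_L definable_intros)
lemmas [definable_intros] = definable_term_subst1[where f = L, OF definable_term_L0]

lemma definable_term_col0: "definable_term (\<lambda>s. col (s 0))"
  unfolding col_def by (intro definable_term_coll is_set_image definable_intros)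
lemmas [definable_intros] = definable_term_subst1[where f = col, OF definable_term_col0]

text \<open>The point \<open>k\<close> makes flips act on roots as well: at level \<open>emp\<close>
  it is the whole area, so roots labelled in one column are supported by that column.\<close>

definition area where "area k m = ins k (L m)"
definition node where "node k m p = pr (pr k m) p"
definition is_node where
  "is_node t \<longleftrightarrow> (\<exists>k m p. k \<epsilon> L omega \<and> m \<epsilon> omega \<and> p \<sqsubseteq> area k m \<and> t = node k m p)"
definition flips where
  "flips g t u \<longleftrightarrow> (\<exists>k m p. t = node k m p \<and> u = node k m (symdiff p (inter g (area k m))))"
definition child where
  "child u t \<longleftrightarrow> (\<exists>k m p. k \<epsilon> L omega \<and> m \<epsilon> omega \<and> p \<sqsubseteq> area k (succ m) \<and>
     t = node k m (inter p (area k m)) \<and> u = node k (succ m) p)"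

lemma node_inject [simp]: "node k m p = node k' m' p' \<longleftrightarrow> k = k' \<and> m = m' \<and> p = p'"
  unfolding node_def by simp

lemma mem_area: "x \<epsilon> area k m \<longleftrightarrow> x = k \<or> x \<epsilon> L m"
  unfolding area_def by simp

lemma area_succ: "area k m \<sqsubseteq> area k (succ m)"
  using L_mono[of m "succ m"] by (auto simp: mem_area sub_def)

lemma definable_term_area [definable_intros]:
  "definable_term a \<Longrightarrow> definable_term b \<Longrightarrow> definable_term (\<lambda>s. area (a s) (b s))"
  unfolding area_def by (intro definable_intros)

lemma definable_term_node [definable_intros]:
  "definable_term a \<Longrightarrow> definable_term b \<Longrightarrow> definable_term c \<Longrightarrow>
   definable_term (\<lambda>s. node (a s) (b s) (c s))"
  unfolding node_def by (intro definable_intros)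

lemma definable_is_node0: "definable (\<lambda>s. is_node (s 0))"
  unfolding is_node_def by (intro definable_intros)
lemmas [definable_intros] = definable_subst1[where R = is_node, OF definable_is_node0]

lemma definable_flips0: "definable (\<lambda>s. flips (s 0) (s (Suc 0)) (s (Suc (Suc 0))))"
  unfolding flips_def by (intro definable_intros)
lemmas [definable_intros] = definable_subst3[where R = flips, OF definable_flips0]

lemma definable_child0: "definable (\<lambda>s. child (s 0) (s (Suc 0)))"
  unfolding child_def by (intro definable_intros)
lemmas [definable_intros] = definable_subst2[where R = child, OF definable_child0]

lemma node_neq_emp [simp]: "is_node t \<Longrightarrow> t \<noteq> emp" "\<not> is_node emp"
proof -
  have "upair a a \<epsilon> pr a b" for a b by (simp add: pr_def)
  then show "is_node t \<Longrightarrow> t \<noteq> emp" "\<not> is_node emp"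
    unfolding is_node_def node_def by (metis mem_emp)+
qed

text \<open>The marker convention rests on this: Kuratowski pairs have nonempty elements only, so a
  set containing \<open>emp\<close> is never a node.\<close>

lemma emp_not_mem_node: "is_node t \<Longrightarrow> \<not> emp \<epsilon> t"
  unfolding is_node_def node_def by auto

lemma child_is_node: "child u t \<Longrightarrow> is_node u \<and> is_node t"
  unfolding child_def is_node_def by (fastforce simp: sub_def)

lemma ex_child: "is_node t \<Longrightarrow> \<exists>u. child u t"
proof -
  assume "is_node t"
  then obtain k m p where t: "k \<epsilon> L omega" "m \<epsilon> omega" "p \<sqsubseteq> area k m" "t = node k m p"
    unfolding is_node_def by blast
  have "p = inter p (area k m)" using t(3) by (intro extensionality) (auto simp: sub_def)
  \<comment> \<open>The same \<open>p\<close>, read as a subset of the larger area, restricts to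
    itself.\<close>
  then have "child (node k (succ m) p) t"
    using t area_succ[of k m] unfolding child_def by (auto simp: sub_def)
  then show ?thesis by blast
qed

text \<open>A child determines its parent by restriction, so a single common child suffices, and one
  exists because the trees have no leaves.\<close>

lemma child_inject:
  assumes "is_node t" "is_node t'" "\<And>u. child u t \<longleftrightarrow> child u t'"
  shows "t = t'"
proof -
  obtain u where u: "child u t" using ex_child assms(1) by blast
  then have u': "child u t'" using assms(3) by blast
  obtain k m p where *: "m \<epsilon> omega" "t = node k m (inter p (area k m))" "u = node k (succ m) p"
    using u unfolding child_def by blast
  obtain k' m' p' where **: "t' = node k' m' (inter p' (area k' m'))" "u = node k' (succ m') p'"
    using u' unfolding child_def by blast
  have "m = m'" using * ** succ_inject by simp
  then show ?thesis using * ** by simp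
qed

lemma flips_unique: "flips g t u \<Longrightarrow> flips g t u' \<Longrightarrow> u = u'"
  unfolding flips_def by auto

lemma ex_flips: "is_node t \<Longrightarrow> \<exists>u. flips g t u"
  unfolding flips_def is_node_def by blast

lemma flips_is_node: "is_node t \<Longrightarrow> flips g t u \<Longrightarrow> is_node u"
  unfolding flips_def is_node_def by (fastforce simp: sub_def)

lemma flips_involutive: "flips g t u \<Longrightarrow> flips g u v \<Longrightarrow> v = t"
proof -
  have "symdiff (symdiff p a) a = p" for p a by (rule extensionality) auto
  then show "flips g t u \<Longrightarrow> flips g u v \<Longrightarrow> v = t" unfolding flips_def by auto
qed

lemma flips_commute: "flips g t u \<Longrightarrow> flips h u v \<Longrightarrow> flips h t u' \<Longrightarrow> flips g u' v' \<Longrightarrow> v = v'"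
proof -
  have "symdiff (symdiff p a) b = symdiff (symdiff p b) a" for p a b by (rule extensionality) auto
  then show "flips g t u \<Longrightarrow> flips h u v \<Longrightarrow> flips h t u' \<Longrightarrow> flips g u' v' \<Longrightarrow> v = v'"
    unfolding flips_def by auto
qed

text \<open>Areas grow with the level, so restricting to the smaller area commutes with the
  symmetric difference.\<close>

lemma child_flips:
  assumes "child u t" "flips g u u'" "flips g t t'"
  shows "child u' t'"
proof -
  obtain k m p where *: "k \<epsilon> L omega" "m \<epsilon> omega" "p \<sqsubseteq> area k (succ m)"
    "t = node k m (inter p (area k m))" "u = node k (succ m) p"
    using assms(1) unfolding child_def by blast
  define q where "q = symdiff p (inter g (area k (succ m)))"
  have u': "u' = node k (succ m) q" using assms(2) * unfolding flips_def q_def by auto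
  have "symdiff (inter p (area k m)) (inter g (area k m)) = inter q (area k m)"
    using area_succ[of k m] unfolding q_def by (intro extensionality) (auto simp: sub_def)
  then have "t' = node k m (inter q (area k m))" using assms(3) * unfolding flips_def by auto
  moreover have "q \<sqsubseteq> area k (succ m)" using *(3) unfolding q_def by (auto simp: sub_def)
  ultimately show ?thesis using * u' unfolding child_def by blast
qed

lemma is_set_child: "is_set (\<lambda>u. child u t)"
proof -
  have "\<exists>a. \<forall>u. child u t \<longrightarrow> u \<epsilon> a"
  proof (cases "is_node t")
    case True
    then obtain k m p where t: "t = node k m p" unfolding is_node_def by blast
    have "is_set (\<lambda>u. \<exists>q. q \<epsilon> pow (area k (succ m)) \<and> u = node k (succ m) q)"
      by (intro is_set_image definable_intros)
    then show ?thesis unfolding t child_def is_set_def by auto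
  next
    case False
    then show ?thesis using child_is_node by blast
  qed
  then obtain a where "\<forall>u. child u t \<longrightarrow> u \<epsilon> a" by blast
  then show ?thesis by (intro is_set_subset[OF is_set_mem[of a]] definable_intros) auto
qed

section \<open>Objects and the action of flips\<close>

text \<open>Nodes act as urelements. Every other object contains the empty set as a marker, which is not
  itself an object of the final model; its extension consists of the remaining elements.\<close>

definition closed where
  "closed d \<longleftrightarrow> (\<forall>x. x \<epsilon> d \<longrightarrow> is_node x \<or> x = emp \<or> emp \<epsilon> x \<and> x \<sqsubseteq> d)"
definition obj where "obj x \<longleftrightarrow> (\<exists>d. closed d \<and> x \<epsilon> d)"

text \<open>A relation between \<open>u\<close> and its image under the flips at \<open>g\<close>: a bisimulation which is
  prescribed at the nodes.\<close>

definition lifts where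
  "lifts g f \<longleftrightarrow> (\<forall>u v. pr u v \<epsilon> f \<longrightarrow> is_node u \<and> flips g u v \<or>
     \<not> is_node u \<and> (\<forall>u'. u' \<epsilon> u \<longrightarrow> (\<exists>v'. v' \<epsilon> v \<and> pr u' v' \<epsilon> f)) \<and>
       (\<forall>v'. v' \<epsilon> v \<longrightarrow> (\<exists>u'. u' \<epsilon> u \<and> pr u' v' \<epsilon> f)))"
definition acts where "acts g x y \<longleftrightarrow> (\<exists>f. lifts g f \<and> pr x y \<epsilon> f)"
text \<open>Non-objects are left alone, which makes \<open>act\<close> total and hence usable as a
  definable term.\<close>

definition act where "act g x = (if obj x then THE y. acts g x y else x)"

lemma definable_closed0: "definable (\<lambda>s. closed (s 0))"
  unfolding closed_def by (intro definable_intros)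
lemmas [definable_intros] = definable_subst1[where R = closed, OF definable_closed0]
lemma definable_obj0: "definable (\<lambda>s. obj (s 0))"
  unfolding obj_def by (intro definable_intros)
lemmas [definable_intros] = definable_subst1[where R = obj, OF definable_obj0]
lemma definable_acts0: "definable (\<lambda>s. acts (s 0) (s (Suc 0)) (s (Suc (Suc 0))))"
  unfolding acts_def lifts_def by (intro definable_intros)
lemmas [definable_intros] = definable_subst3[where R = acts, OF definable_acts0]

lemma closed_singleton: "is_node x \<or> x = emp \<Longrightarrow> closed (upair x x)"
  unfolding closed_def by auto

lemma obj_node: "is_node x \<Longrightarrow> obj x"
  using closed_singleton unfolding obj_def by (metis mem_upair)

lemma obj_emp: "obj emp"
  using closed_singleton unfolding obj_def by (metis mem_upair)

lemma obj_cases: "obj x \<Longrightarrow> is_node x \<or> x = emp \<or> emp \<epsilon> x"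
  unfolding obj_def closed_def by blast

lemma obj_mem: "obj x \<Longrightarrow> \<not> is_node x \<Longrightarrow> u \<epsilon> x \<Longrightarrow> obj u"
  unfolding obj_def closed_def sub_def by (metis mem_emp)

text \<open>A minimal counterexample is sought inside a closed set around \<open>x\<close>, which
  plays the role of a transitive closure. Nodes count as atoms, so their set-theoretic elements are
  never visited.\<close>

lemma obj_induct [consumes 1, case_names definable step]:
  assumes "obj x" "definable (\<lambda>s. P (s 0))"
    "\<And>x. obj x \<Longrightarrow> (\<And>u. \<not> is_node x \<Longrightarrow> u \<epsilon> x \<Longrightarrow> P u) \<Longrightarrow> P x"
  shows "P x"
proof (rule ccontr)
  assume "\<not> P x"
  obtain d where d: "closed d" "x \<epsilon> d" using assms(1) unfolding obj_def by blast
  have set: "is_set (\<lambda>y. y \<epsilon> d \<and> \<not> P y)"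
    by (intro is_set_separation definable_not assms(2))
  have "x \<epsilon> coll (\<lambda>y. y \<epsilon> d \<and> \<not> P y)" using d \<open>\<not> P x\<close> by (simp add: mem_coll[OF set])
  then obtain y where y: "y \<epsilon> d" "\<not> P y" "\<And>z. z \<epsilon> d \<Longrightarrow> \<not> P z \<Longrightarrow> \<not> z \<epsilon> y"
    using foundation[of x "coll (\<lambda>y. y \<epsilon> d \<and> \<not> P y)"] unfolding mem_coll[OF set] by blast
  have "P y"
  proof (rule assms(3))
    show "obj y" using d y(1) unfolding obj_def by blast
    fix u assume "\<not> is_node y" "u \<epsilon> y"
    then have "u \<epsilon> d" using d(1) y(1) unfolding closed_def sub_def by (metis mem_emp)
    then show "P u" using y(3) \<open>u \<epsilon> y\<close> by blast
  qed
  then show False using y(2) by blast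
qed

section \<open>Uniqueness and existence of the image under a flip\<close>

lemma acts_cases:
  assumes "acts g x y"
  shows "is_node x \<and> flips g x y \<or>
     \<not> is_node x \<and> (\<forall>u. u \<epsilon> x \<longrightarrow> (\<exists>v. v \<epsilon> y \<and> acts g u v)) \<and>
       (\<forall>v. v \<epsilon> y \<longrightarrow> (\<exists>u. u \<epsilon> x \<and> acts g u v))"
proof -
  obtain f where f: "lifts g f" "pr x y \<epsilon> f" using assms unfolding acts_def by blast
  have "acts g u v" if "pr u v \<epsilon> f" for u v using f(1) that unfolding acts_def by blast
  then show ?thesis using f(1)[unfolded lifts_def, rule_format, OF f(2)] by meson
qed

lemma acts_unique: "obj x \<Longrightarrow> acts g x y \<Longrightarrow> acts g x z \<Longrightarrow> y = z"
proof (induction x arbitrary: y z rule: obj_induct)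
  case definable
  show ?case by (intro definable_intros)
next
  case (step x)
  show ?case
  proof (cases "is_node x")
    case True
    then show ?thesis using acts_cases[OF step.prems(1)] acts_cases[OF step.prems(2)] flips_unique by blast
  next
    case False
    show ?thesis
    proof (rule extensionality)
      fix v
      show "v \<epsilon> y \<longleftrightarrow> v \<epsilon> z"
        using acts_cases[OF step.prems(1)] acts_cases[OF step.prems(2)] step.IH[OF False] False by metis
    qed
  qed
qed

text \<open>By induction every member of \<open>x\<close> has an image, unique by
  \<open>acts_unique\<close>, so Replacement collects the image of \<open>x\<close> and, over a
  closed set containing \<open>x\<close>, the pairs already related. Adjoining the pair of
  \<open>x\<close> and its image yields one bisimulation.\<close>

lemma ex_acts: "obj x \<Longrightarrow> \<exists>y. acts g x y"
proof (induction x rule: obj_induct)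
  case definable
  show ?case by (intro definable_intros)
next
  case (step x)
  show ?case
  proof (cases "is_node x")
    case True
    then obtain y where "flips g x y" using ex_flips by blast
    then have "lifts g (upair (pr x y) (pr x y))" using True unfolding lifts_def by simp
    then show ?thesis unfolding acts_def by (metis mem_upair)
  next
    case False
    obtain d where d: "closed d" "x \<epsilon> d" using step.hyps unfolding obj_def by blast
    have d_mem: "u \<epsilon> d" if "w \<epsilon> d" "\<not> is_node w" "u \<epsilon> w" for u w
      using d(1) that unfolding closed_def sub_def by (metis mem_emp)
    have d_obj: "obj w" if "w \<epsilon> d" for w using d(1) that unfolding obj_def by blast
    have "is_set (\<lambda>z. \<exists>w. w \<epsilon> d \<and> (\<exists>v. acts g w v \<and> z = pr w v))"
      by (rule is_set_replacement) (auto intro!: definable_intros dest: acts_unique d_obj)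
    then obtain f where f: "\<And>z. z \<epsilon> f \<longleftrightarrow> (\<exists>w. w \<epsilon> d \<and> (\<exists>v. acts g w v \<and> z = pr w v))"
      unfolding is_set_def by blast
    have "is_set (\<lambda>v. \<exists>u. u \<epsilon> x \<and> acts g u v)"
    proof (rule is_set_replacement)
      show "definable (\<lambda>s. acts g (s 0) (s (Suc 0)))" by (intro definable_intros)
      show "y = z" if "u \<epsilon> x" "acts g u y" "acts g u z" for u y z
        using acts_unique[OF d_obj[OF d_mem[OF d(2) False that(1)]] that(2,3)] .
    qed
    then obtain y where y: "\<And>v. v \<epsilon> y \<longleftrightarrow> (\<exists>u. u \<epsilon> x \<and> acts g u v)"
      unfolding is_set_def by blast
    have f_pr: "pr u v \<epsilon> f \<longleftrightarrow> u \<epsilon> d \<and> acts g u v" for u v unfolding f by auto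
    have "lifts g (ins (pr x y) f)"
      unfolding lifts_def
    proof (intro allI impI)
      fix u v assume "pr u v \<epsilon> ins (pr x y) f"
      then consider "u = x" "v = y" | "u \<epsilon> d" "acts g u v" unfolding mem_ins f_pr by auto
      then show "is_node u \<and> flips g u v \<or> \<not> is_node u \<and>
          (\<forall>u'. u' \<epsilon> u \<longrightarrow> (\<exists>v'. v' \<epsilon> v \<and> pr u' v' \<epsilon> ins (pr x y) f)) \<and>
          (\<forall>v'. v' \<epsilon> v \<longrightarrow> (\<exists>u'. u' \<epsilon> u \<and> pr u' v' \<epsilon> ins (pr x y) f))"
      proof cases
        case 1
        have "\<forall>u'. u' \<epsilon> x \<longrightarrow> (\<exists>v'. v' \<epsilon> y \<and> pr u' v' \<epsilon> f)"
          using step.IH[OF False] d_mem[OF d(2) False] unfolding f_pr y by blast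
        moreover have "\<forall>v'. v' \<epsilon> y \<longrightarrow> (\<exists>u'. u' \<epsilon> x \<and> pr u' v' \<epsilon> f)"
          using d_mem[OF d(2) False] unfolding f_pr y by blast
        ultimately show ?thesis using False 1 by auto
      next
        case 2
        show ?thesis
          using acts_cases[OF 2(2)] d_mem[OF 2(1)] unfolding mem_ins f_pr by blast
      qed
    qed
    then show ?thesis unfolding acts_def by (metis mem_ins)
  qed
qed

text \<open>This form eliminates the description operator, so that the graph of \<open>act\<close>
  is visibly definable.\<close>

lemma act_eq_iff: "y = act g x \<longleftrightarrow> (if obj x then acts g x y else y = x)"
proof (cases "obj x")
  case True
  then have "\<exists>!y. acts g x y" using ex_acts acts_unique by blast
  then show ?thesis using True unfolding act_def by (metis theI')
qed (simp add: act_def)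

lemma definable_term_act0: "definable_term (\<lambda>s. act (s 0) (s (Suc 0)))"
  unfolding definable_term_def act_eq_iff if_bool_eq_conj by (intro definable_intros)
lemmas [definable_intros] = definable_term_subst2[where f = act, OF definable_term_act0]

section \<open>Flips as commuting involutions\<close>

lemma acts_act: "obj x \<Longrightarrow> acts g x (act g x)"
  using act_eq_iff[of "act g x" g x] by simp

lemma flips_act: "is_node x \<Longrightarrow> flips g x (act g x)"
  using acts_cases[OF acts_act[OF obj_node]] by blast

lemma mem_act: "obj x \<Longrightarrow> \<not> is_node x \<Longrightarrow> v \<epsilon> act g x \<longleftrightarrow> (\<exists>u. u \<epsilon> x \<and> v = act g u)"
  using acts_cases[OF acts_act, of x g] act_eq_iff obj_mem by metis

lemma act_emp [simp]: "act g emp = emp"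
  using mem_act[OF obj_emp, of _ g] by (simp add: emp_iff[of "act g emp"])

text \<open>Nodes go to nodes; any other object is \<open>emp\<close> or contains the marker, which
  every flip fixes and no node contains.\<close>

lemma is_node_act: "obj x \<Longrightarrow> is_node (act g x) \<longleftrightarrow> is_node x"
proof (cases "is_node x")
  case True
  then show ?thesis using flips_is_node flips_act by blast
next
  case False
  assume "obj x"
  then have "act g x = emp \<or> emp \<epsilon> act g x"
    using obj_cases[of x] False mem_act[of x emp g] by (metis act_emp)
  then show ?thesis using False emp_not_mem_node by auto
qed

lemma closed_act_image:
  assumes "closed d" "\<And>y. y \<epsilon> e \<longleftrightarrow> (\<exists>w. w \<epsilon> d \<and> y = act g w)"
  shows "closed e"
  unfolding closed_def
proof (intro allI impI)
  fix y assume "y \<epsilon> e"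
  then obtain w where w: "w \<epsilon> d" "y = act g w" using assms(2) by blast
  then have "obj w" using assms(1) unfolding obj_def by blast
  show "is_node y \<or> y = emp \<or> emp \<epsilon> y \<and> y \<sqsubseteq> e"
  proof (cases "is_node w \<or> w = emp")
    case True
    then show ?thesis using w is_node_act[OF \<open>obj w\<close>] by auto
  next
    case False
    then have "emp \<epsilon> w" "w \<sqsubseteq> d" using assms(1) w(1) unfolding closed_def by blast+
    then show ?thesis
      using mem_act[OF \<open>obj w\<close>] False w(2) assms(2) unfolding sub_def by (metis act_emp)
  qed
qed

lemma obj_act: "obj x \<Longrightarrow> obj (act g x)"
proof -
  assume "obj x"
  then obtain d where d: "closed d" "x \<epsilon> d" unfolding obj_def by blast
  have "is_set (\<lambda>y. \<exists>w. w \<epsilon> d \<and> y = act g w)" by (intro is_set_image definable_intros)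
  then obtain e where e: "\<And>y. y \<epsilon> e \<longleftrightarrow> (\<exists>w. w \<epsilon> d \<and> y = act g w)" unfolding is_set_def by blast
  then show ?thesis using closed_act_image[OF d(1) e] d(2) unfolding obj_def by blast
qed

lemma act_act: "obj x \<Longrightarrow> act g (act g x) = x"
proof (induction x rule: obj_induct)
  case definable
  show ?case by (intro definable_intros)
next
  case (step x)
  show ?case
  proof (cases "is_node x")
    case True
    then show ?thesis using flips_involutive flips_act is_node_act step.hyps by blast
  next
    case False
    then show ?thesis
      using step mem_act[OF step.hyps False] mem_act[OF obj_act[OF step.hyps]] is_node_act
      by (intro extensionality) metis
  qed
qed

lemma act_commute: "obj x \<Longrightarrow> act g (act h x) = act h (act g x)"
proof (induction x rule: obj_induct)
  case definable
  show ?case by (intro definable_intros)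
next
  case (step x)
  show ?case
  proof (cases "is_node x")
    case True
    then have "is_node (act g x)" "is_node (act h x)" using is_node_act step.hyps by blast+
    then show ?thesis
      using flips_commute[OF flips_act flips_act flips_act flips_act] True by blast
  next
    case False
    have *: "v \<epsilon> act g (act h x) \<longleftrightarrow> (\<exists>u. u \<epsilon> x \<and> v = act g (act h u))" for g h v
      using mem_act[OF step.hyps False] mem_act[OF obj_act[OF step.hyps]] is_node_act[OF step.hyps]
        False by auto
    show ?thesis by (rule extensionality) (use step.IH[OF False] * in auto)
  qed
qed

lemma act_inject: "obj x \<Longrightarrow> obj y \<Longrightarrow> act g x = act g y \<longleftrightarrow> x = y"
  using act_act by metis

text \<open>The elements of the pair coding a node are forgotten in favour of its children, and the
  marker is hidden.\<close>

definition E where "E u x \<longleftrightarrow> child u x \<or> \<not> is_node x \<and> u \<epsilon> x \<and> u \<noteq> emp"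

lemma definable_E0: "definable (\<lambda>s. E (s 0) (s (Suc 0)))"
  unfolding E_def by (intro definable_intros)
lemmas [definable_intros] = definable_subst2[where R = E, OF definable_E0]

lemma is_set_E: "is_set (\<lambda>u. E u x)"
proof -
  have "is_set (\<lambda>u. u \<epsilon> x \<and> (\<not> is_node x \<and> u \<noteq> emp))"
    by (intro is_set_separation definable_intros)
  from is_set_disj[OF is_set_child this] show ?thesis
    unfolding E_def by (rule back_subst[where P = is_set]) auto
qed

lemma obj_E: "obj x \<Longrightarrow> E u x \<Longrightarrow> obj u"
  unfolding E_def using child_is_node obj_node obj_mem by blast

text \<open>Flips are automorphisms of the structure. Since each is an involution on objects, one
  implication already yields the converse.\<close>

lemma E_act: "obj u \<Longrightarrow> obj x \<Longrightarrow> E (act g u) (act g x) \<longleftrightarrow> E u x"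
proof -
  have *: "E (act g u) (act g x)" if "obj u" "obj x" "E u x" for u x
  proof (cases "is_node x")
    case True
    then have "child u x" using that unfolding E_def by blast
    then show ?thesis using child_flips flips_act child_is_node unfolding E_def by blast
  next
    case False
    then have "u \<epsilon> x" "u \<noteq> emp" using that child_is_node unfolding E_def by blast+
    then show ?thesis using False mem_act[OF that(2) False] is_node_act[OF that(2)]
        act_inject[OF that(1) obj_emp, of g] unfolding E_def by auto
  qed
  assume "obj u" "obj x"
  then show ?thesis using *[of u x] *[of "act g u" "act g x"] act_act obj_act by metis
qed

section \<open>The model\<close>

text \<open>The set \<open>Q\<close> names a subgroup, the flips disjoint from \<open>Q\<close>;
  enlarging \<open>Q\<close> shrinks it.\<close>

definition supports where
  "supports Q x \<longleftrightarrow> (\<forall>g. (\<forall>z. z \<epsilon> g \<longrightarrow> \<not> z \<epsilon> Q) \<longrightarrow> act g x = x)"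
definition symm where "symm x \<longleftrightarrow> (\<exists>m. m \<epsilon> omega \<and> supports (L m) x)"
definition small where
  "small x \<longleftrightarrow> (\<exists>m i. m \<epsilon> omega \<and> bit i \<and> (\<forall>u. E u x \<longrightarrow> supports (un (L m) (col i)) u))"
text \<open>The last clause discards a marked set with the same members as a node: it would be a
  second copy of that node and violate Extensionality.\<close>

definition good where
  "good x \<longleftrightarrow> x = emp \<or> is_node x \<or>
     emp \<epsilon> x \<and> symm x \<and> small x \<and> \<not> (\<exists>t. is_node t \<and> (\<forall>u. E u t \<longleftrightarrow> E u x))"
text \<open>The witness \<open>d\<close> expresses that goodness is hereditary. The marker
  \<open>emp\<close> is left out; the empty set of the new model is \<open>succ emp\<close>.\<close>

definition M where
  "M = {x. x \<noteq> emp \<and> (\<exists>d. closed d \<and> x \<epsilon> d \<and> (\<forall>y. y \<epsilon> d \<longrightarrow> good y))}"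

lemma definable_supports0: "definable (\<lambda>s. supports (s 0) (s (Suc 0)))"
  unfolding supports_def by (intro definable_intros)
lemmas [definable_intros] = definable_subst2[where R = supports, OF definable_supports0]
lemma definable_symm0: "definable (\<lambda>s. symm (s 0))"
  unfolding symm_def by (intro definable_intros)
lemmas [definable_intros] = definable_subst1[where R = symm, OF definable_symm0]
lemma definable_small0: "definable (\<lambda>s. small (s 0))"
  unfolding small_def by (intro definable_intros)
lemmas [definable_intros] = definable_subst1[where R = small, OF definable_small0]
lemma definable_good0: "definable (\<lambda>s. good (s 0))"
  unfolding good_def by (intro definable_intros)
lemmas [definable_intros] = definable_subst1[where R = good, OF definable_good0]
lemma definable_M0: "definable (\<lambda>s. s 0 \<in> M)"
  unfolding M_def mem_Collect_eq by (intro definable_intros)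
lemmas [definable_intros] = definable_subst1[where R = "\<lambda>x. x \<in> M", OF definable_M0]

section \<open>Supports of nodes\<close>

lemma supportsD: "supports Q x \<Longrightarrow> (\<And>z. z \<epsilon> g \<Longrightarrow> \<not> z \<epsilon> Q) \<Longrightarrow> act g x = x"
  unfolding supports_def by blast

lemma supports_mono: "supports Q x \<Longrightarrow> Q \<sqsubseteq> Q' \<Longrightarrow> supports Q' x"
  unfolding supports_def sub_def by blast

text \<open>Commutativity lets the same \<open>Q\<close> serve for the image; in a nonabelian group
  it would have to be moved along.\<close>

lemma supports_act: "obj x \<Longrightarrow> supports Q x \<Longrightarrow> supports Q (act h x)"
  unfolding supports_def using act_commute by metis

text \<open>A point of the area outside \<open>Q\<close> can be flipped on its own, and this changes
  \<open>p\<close>.\<close>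

lemma supports_node_iff:
  assumes "is_node (node k m p)"
  shows "supports Q (node k m p) \<longleftrightarrow> area k m \<sqsubseteq> Q"
proof -
  have act: "act g (node k m p) = node k m (symdiff p (inter g (area k m)))" for g
    using flips_act[OF assms, of g] unfolding flips_def by auto
  show ?thesis
  proof
    assume *: "supports Q (node k m p)"
    have "z \<epsilon> Q" if "z \<epsilon> area k m" for z
    proof (rule ccontr)
      assume "\<not> z \<epsilon> Q"
      then have "act (upair z z) (node k m p) = node k m p" by (intro supportsD[OF *]) simp
      then have "symdiff p (inter (upair z z) (area k m)) = p" unfolding act by simp
      then have "z \<epsilon> symdiff p (inter (upair z z) (area k m)) \<longleftrightarrow> z \<epsilon> p" by simp
      then show False using that by simp
    qed
    then show "area k m \<sqsubseteq> Q" unfolding sub_def by blast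
  next
    assume *: "area k m \<sqsubseteq> Q"
    show "supports Q (node k m p)"
      unfolding supports_def act
    proof (intro allI impI)
      fix g assume "\<forall>z. z \<epsilon> g \<longrightarrow> \<not> z \<epsilon> Q"
      then have "symdiff p (inter g (area k m)) = p"
        using * by (intro extensionality) (auto simp: sub_def)
      then show "node k m (symdiff p (inter g (area k m))) = node k m p" by simp
    qed
  qed
qed

lemma omega_bound2: "m \<epsilon> omega \<Longrightarrow> n \<epsilon> omega \<Longrightarrow> \<exists>l. l \<epsilon> omega \<and> m \<sqsubseteq> l \<and> n \<sqsubseteq> l"
  using omega_linear[of m n] unfolding sub_def by blast

lemma area_bounded:
  assumes "k \<epsilon> L omega" "m \<epsilon> omega"
  shows "\<exists>n. n \<epsilon> omega \<and> area k m \<sqsubseteq> L n"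
proof -
  obtain j i where k: "j \<epsilon> omega" "bit i" "k = pr j i" using assms(1) unfolding mem_L by blast
  \<comment> \<open>It has to be \<open>succ j\<close>: the label \<open>pr j i\<close> lies in
    \<open>L n\<close> only if \<open>j \<epsilon> n\<close>.\<close>
  obtain n where n: "n \<epsilon> omega" "succ j \<sqsubseteq> n" "m \<sqsubseteq> n"
    using omega_bound2[of "succ j" m] k(1) assms(2) by auto
  have "k \<epsilon> L n" using k n(2) unfolding mem_L sub_def by auto
  then have "area k m \<sqsubseteq> L n" using L_mono[OF n(3)] unfolding sub_def mem_area by auto
  then show ?thesis using n(1) by blast
qed

lemma sub_un1: "a \<sqsubseteq> c \<Longrightarrow> a \<sqsubseteq> un c b" unfolding sub_def by simp

lemma symm_node: "is_node t \<Longrightarrow> symm t"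
proof -
  assume t: "is_node t"
  then obtain k m p where *: "k \<epsilon> L omega" "m \<epsilon> omega" "t = node k m p" unfolding is_node_def by blast
  then show ?thesis using area_bounded[OF *(1,2)] supports_node_iff t unfolding symm_def by blast
qed

lemma E_node: "is_node t \<Longrightarrow> E u t \<longleftrightarrow> child u t" unfolding E_def by blast

lemma small_node: "is_node t \<Longrightarrow> small t"
proof -
  assume t: "is_node t"
  then obtain k m p where *: "k \<epsilon> L omega" "m \<epsilon> omega" "t = node k m p" unfolding is_node_def by blast
  obtain n where n: "n \<epsilon> omega" "area k (succ m) \<sqsubseteq> L n"
    using area_bounded[OF *(1) succ_omega[OF *(2)]] by blast
  \<comment> \<open>All children of \<open>t\<close> have the same area, and it is contained in
    \<open>L n\<close>, so either colour can be chosen.\<close>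
  have "supports (un (L n) (col emp)) u" if "E u t" for u
  proof -
    have "child u t" using that t E_node by blast
    moreover from this obtain q where "u = node k (succ m) q" unfolding child_def *(3) by auto
    ultimately show ?thesis using supports_node_iff child_is_node sub_un1[OF n(2)] by metis
  qed
  then show ?thesis using n(1) unfolding small_def bit_def by blast
qed

section \<open>Members of the model and how to construct them\<close>

lemma M_obj: "x \<in> M \<Longrightarrow> obj x" unfolding M_def obj_def by blast

lemma M_good: "x \<in> M \<Longrightarrow> good x" unfolding M_def by blast

lemma M_symm: "x \<in> M \<Longrightarrow> symm x"
  using M_good symm_node unfolding good_def by (auto simp: M_def)

lemma M_small: "x \<in> M \<Longrightarrow> small x"
  using M_good small_node unfolding good_def by (auto simp: M_def)

lemma node_M: "is_node x \<Longrightarrow> x \<in> M"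
  unfolding M_def using closed_singleton[of x] by (auto simp: good_def intro!: exI[of _ "upair x x"])

lemma E_M: "x \<in> M \<Longrightarrow> E u x \<Longrightarrow> u \<in> M"
proof (cases "is_node x")
  case True
  then show "E u x \<Longrightarrow> u \<in> M" unfolding E_def using child_is_node node_M by blast
next
  case False
  assume "x \<in> M" "E u x"
  then obtain d where d: "closed d" "x \<epsilon> d" "\<forall>y. y \<epsilon> d \<longrightarrow> good y" unfolding M_def by blast
  have "u \<epsilon> x" "u \<noteq> emp" using \<open>E u x\<close> False child_is_node unfolding E_def by blast+
  then have "u \<epsilon> d" using d(1,2) False unfolding closed_def sub_def by (metis mem_emp)
  then show ?thesis using d \<open>u \<noteq> emp\<close> unfolding M_def by blast
qed

text \<open>The least witnesses depend functionally on their element, so they can be collected without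
  choice.\<close>

lemma ex_closed_superset:
  assumes "definable (\<lambda>s. P (s 0))"
    and "\<And>u. u \<epsilon> x \<Longrightarrow> \<exists>d. closed d \<and> u \<epsilon> d \<and> (\<forall>y. y \<epsilon> d \<longrightarrow> P y)"
  shows "\<exists>d. closed d \<and> x \<sqsubseteq> d \<and> (\<forall>y. y \<epsilon> d \<longrightarrow> P y)"
proof -
  define W where "W u d \<longleftrightarrow> closed d \<and> u \<epsilon> d \<and> (\<forall>y. y \<epsilon> d \<longrightarrow> P y)" for u d
  define H where "H u e \<longleftrightarrow> (\<forall>w. w \<epsilon> e \<longleftrightarrow> (\<forall>d. W u d \<longrightarrow> w \<epsilon> d))" for u e
  note [definable_intros] = definable_subst1[where R = P, OF assms(1)]
  have "definable (\<lambda>s. W (s 0) (s (Suc 0)))" unfolding W_def by (intro definable_intros)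
  note [definable_intros] = definable_subst2[where R = W, OF this]
  have "is_set (\<lambda>e. \<exists>u. u \<epsilon> x \<and> H u e)"
  proof (rule is_set_replacement)
    show "definable (\<lambda>s. H (s 0) (s (Suc 0)))" unfolding H_def by (intro definable_intros)
    show "y = z" if "H u y" "H u z" for u y z
      using that unfolding H_def by (intro extensionality) blast
  qed
  then obtain c where c: "\<And>e. e \<epsilon> c \<longleftrightarrow> (\<exists>u. u \<epsilon> x \<and> H u e)" unfolding is_set_def by blast
  have H: "W u e" if "u \<epsilon> x" "H u e" for u e
  proof -
    obtain d where d: "W u d" using assms(2)[OF \<open>u \<epsilon> x\<close>] unfolding W_def by blast
    have e: "w \<epsilon> e \<longleftrightarrow> (\<forall>d. W u d \<longrightarrow> w \<epsilon> d)" for w using that(2) unfolding H_def by blast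
    have "u \<epsilon> e" unfolding e W_def by blast
    moreover have "\<forall>y. y \<epsilon> e \<longrightarrow> P y" using d unfolding e W_def by blast
    moreover have "closed e" unfolding closed_def
    proof (intro allI impI)
      fix y assume y: "y \<epsilon> e"
      show "is_node y \<or> y = emp \<or> emp \<epsilon> y \<and> y \<sqsubseteq> e"
      proof (cases "is_node y \<or> y = emp")
        case False
        then have "emp \<epsilon> y \<and> y \<sqsubseteq> d" if "W u d" for d
          using that y unfolding e W_def closed_def by blast
        then show ?thesis using d unfolding sub_def e by blast
      qed blast
    qed
    ultimately show ?thesis unfolding W_def by blast
  qed
  have ex: "\<exists>e. H u e" if "u \<epsilon> x" for u
  proof -
    obtain d where d: "W u d" using assms(2)[OF \<open>u \<epsilon> x\<close>] unfolding W_def by blast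
    have "is_set (\<lambda>w. \<forall>d. W u d \<longrightarrow> w \<epsilon> d)"
      by (rule is_set_subset[OF is_set_mem[of d]]) (use d in \<open>auto intro!: definable_intros\<close>)
    then show ?thesis unfolding is_set_def H_def by blast
  qed
  have mem: "w \<epsilon> bigun c \<longleftrightarrow> (\<exists>u e. u \<epsilon> x \<and> H u e \<and> w \<epsilon> e)" for w by (auto simp: c)
  have "closed (bigun c)"
    unfolding closed_def
  proof (intro allI impI)
    fix w assume "w \<epsilon> bigun c"
    then obtain u e where *: "u \<epsilon> x" "H u e" "w \<epsilon> e" unfolding mem by blast
    then have "is_node w \<or> w = emp \<or> emp \<epsilon> w \<and> w \<sqsubseteq> e" using H unfolding W_def closed_def by blast
    then show "is_node w \<or> w = emp \<or> emp \<epsilon> w \<and> w \<sqsubseteq> bigun c"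
      using *(1,2) unfolding sub_def mem by blast
  qed
  moreover have "x \<sqsubseteq> bigun c" unfolding sub_def mem using ex H unfolding W_def by blast
  moreover have "\<forall>y. y \<epsilon> bigun c \<longrightarrow> P y" unfolding mem using H unfolding W_def by blast
  ultimately show ?thesis by blast
qed

lemma closed_ins: "closed d \<Longrightarrow> x \<sqsubseteq> d \<Longrightarrow> emp \<epsilon> x \<Longrightarrow> closed (ins x d)"
  unfolding closed_def sub_def by auto

lemma objI:
  assumes "emp \<epsilon> x" "\<And>u. u \<epsilon> x \<Longrightarrow> u \<noteq> emp \<Longrightarrow> obj u"
  shows "obj x"
proof -
  \<comment> \<open>The trivial predicate, written as a negation so that its definability is at
    hand; only closedness is of interest.\<close>
  have "\<exists>d. closed d \<and> u \<epsilon> d \<and> (\<forall>y. y \<epsilon> d \<longrightarrow> \<not> False)" if "u \<epsilon> x" for u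
    using assms(2)[OF that] obj_emp unfolding obj_def by blast
  then obtain d where "closed d" "x \<sqsubseteq> d"
    using ex_closed_superset[OF definable_not[OF definable_False], of x] by blast
  then show ?thesis using closed_ins[OF _ _ assms(1)] unfolding obj_def by (metis mem_ins)
qed

lemma not_node_marked: "emp \<epsilon> x \<Longrightarrow> \<not> is_node x" using emp_not_mem_node by blast

lemma MI:
  assumes "emp \<epsilon> x" "\<And>u. u \<epsilon> x \<Longrightarrow> u \<noteq> emp \<Longrightarrow> u \<in> M" "symm x" "small x"
    "\<not> (\<exists>t. is_node t \<and> (\<forall>u. E u t \<longleftrightarrow> E u x))"
  shows "x \<in> M"
proof -
  have "good emp" by (simp add: good_def)
  then have "\<exists>d. closed d \<and> u \<epsilon> d \<and> (\<forall>y. y \<epsilon> d \<longrightarrow> good y)" if "u \<epsilon> x" for u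
    using assms(2)[OF that] closed_singleton[of emp] unfolding M_def
    by (cases "u = emp") (auto intro!: exI[of _ "upair emp emp"])
  then obtain d where d: "closed d" "x \<sqsubseteq> d" "\<forall>y. y \<epsilon> d \<longrightarrow> good y"
    using ex_closed_superset[OF definable_good0, of x] by blast
  have "good x" using assms unfolding good_def by blast
  moreover have "closed (ins x d)" using closed_ins[OF d(1,2) assms(1)] .
  ultimately show ?thesis using d(3) assms(1) unfolding M_def by (auto intro!: exI[of _ "ins x d"])
qed

lemma E_marked: "emp \<epsilon> x \<Longrightarrow> E u x \<longleftrightarrow> u \<epsilon> x \<and> u \<noteq> emp"
  unfolding E_def using not_node_marked child_is_node by blast

text \<open>Comprehension, Replacement, Pairing and Power Set all go through this: invariance of
  \<open>X\<close> makes the new set symmetric, the uniform support makes it small. If a node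
  already has these members, the node is the answer, since the marked set would not be good.\<close>

lemma ex_M_extension:
  assumes "is_set X" "\<And>u. X u \<Longrightarrow> u \<in> M"
    and "m \<epsilon> omega" "\<And>g u. (\<And>z. z \<epsilon> g \<Longrightarrow> \<not> z \<epsilon> L m) \<Longrightarrow> X u \<Longrightarrow> X (act g u)"
    and "n \<epsilon> omega" "bit i" "\<And>u. X u \<Longrightarrow> supports (un (L n) (col i)) u"
  shows "\<exists>x\<in>M. \<forall>u. E u x \<longleftrightarrow> X u"
proof (cases "\<exists>t. is_node t \<and> (\<forall>u. E u t \<longleftrightarrow> X u)")
  case True
  then show ?thesis using node_M by blast
next
  case False
  define x where "x = ins emp (coll X)"
  have mem: "u \<epsilon> x \<longleftrightarrow> u = emp \<or> X u" for u unfolding x_def by (simp add: mem_coll[OF assms(1)])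
  have X_emp: "X u \<Longrightarrow> u \<noteq> emp" for u using assms(2) unfolding M_def by blast
  have E: "E u x \<longleftrightarrow> X u" for u using E_marked[of x u] X_emp by (auto simp: mem)
  have obj: "obj x" by (rule objI) (use assms(2) M_obj in \<open>auto simp: mem\<close>)
  have "supports (L m) x"
    unfolding supports_def
  proof (intro allI impI extensionality)
    fix g v assume g: "\<forall>z. z \<epsilon> g \<longrightarrow> \<not> z \<epsilon> L m"
    have "v \<epsilon> act g x \<longleftrightarrow> v = emp \<or> (\<exists>u. X u \<and> v = act g u)"
      using mem_act[OF obj, of v g] not_node_marked[of x] by (auto simp: mem)
    \<comment> \<open>Invariance gives one inclusion, and applied to \<open>act g v\<close> it gives
      the other, flips being involutions.\<close>
    moreover have "(\<exists>u. X u \<and> v = act g u) \<longleftrightarrow> X v"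
      using assms(4)[of g] g act_act M_obj assms(2) by metis
    ultimately show "v \<epsilon> act g x \<longleftrightarrow> v \<epsilon> x" unfolding mem by blast
  qed
  then have "symm x" using assms(3) unfolding symm_def by blast
  moreover have "small x" using assms(5,6,7) E unfolding small_def by blast
  ultimately have "x \<in> M" using MI[of x] False assms(2) E by (auto simp: mem)
  then show ?thesis using E by blast
qed

section \<open>Invariance of the model under flips\<close>

text \<open>The same \<open>m\<close> and \<open>i\<close> witness smallness of the image, and a
  node coextensional with the image is flipped back to one coextensional with
  \<open>x\<close>.\<close>

lemma good_act:
  assumes "obj x" "good x"
  shows "good (act g x)"
proof (cases "x = emp \<or> is_node x")
  case True
  then show ?thesis using is_node_act assms(1) unfolding good_def by auto
next
  case False
  then have x: "emp \<epsilon> x" "symm x" "small x" "\<not> (\<exists>t. is_node t \<and> (\<forall>u. E u t \<longleftrightarrow> E u x))"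
    using assms(2) unfolding good_def by blast+
  have "emp \<epsilon> act g x" using mem_act[OF assms(1)] x(1) False by (metis act_emp)
  moreover have "symm (act g x)" using x(2) supports_act[OF assms(1)] unfolding symm_def by blast
  moreover have E_swap: "E u (act g y) \<longleftrightarrow> E (act g u) y" if "obj u" "obj y" for u y
    using E_act[of "act g u" y g] act_act obj_act that by metis
  have "small (act g x)"
  proof -
    obtain m i where mi: "m \<epsilon> omega" "bit i" "\<And>u. E u x \<Longrightarrow> supports (un (L m) (col i)) u"
      using x(3) unfolding small_def by blast
    have "supports (un (L m) (col i)) u" if "E u (act g x)" for u
    proof -
      have u: "obj u" using obj_E[OF obj_act[OF assms(1)] that] .
      then have "supports (un (L m) (col i)) (act g u)" using mi(3) E_swap[OF u assms(1)] that by blast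
      then have "supports (un (L m) (col i)) (act g (act g u))" using supports_act obj_act u by blast
      then show ?thesis using act_act[OF u] by simp
    qed
    then show ?thesis using mi unfolding small_def by blast
  qed
  moreover have "\<not> (\<exists>t. is_node t \<and> (\<forall>u. E u t \<longleftrightarrow> E u (act g x)))"
  proof
    assume "\<exists>t. is_node t \<and> (\<forall>u. E u t \<longleftrightarrow> E u (act g x))"
    then obtain t where t: "is_node t" "\<And>u. E u t \<longleftrightarrow> E u (act g x)" by blast
    have "E u (act g t) \<longleftrightarrow> E u x" for u
    proof (cases "obj u")
      case True
      then have "E u (act g t) \<longleftrightarrow> E (act g u) (act g x)" using E_swap obj_node t by simp
      then show ?thesis using E_act True assms(1) by blast
    next
      case False
      then show ?thesis using obj_E assms(1) obj_act obj_node t(1) by blast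
    qed
    moreover have "is_node (act g t)" using is_node_act obj_node t(1) by blast
    ultimately show False using x(4) by blast
  qed
  ultimately show ?thesis unfolding good_def by blast
qed

lemma M_act: "x \<in> M \<Longrightarrow> act g x \<in> M"
proof -
  assume x: "x \<in> M"
  then have "x \<noteq> emp" unfolding M_def by blast
  then have ne: "act g x \<noteq> emp" using act_inject[OF M_obj[OF x] obj_emp, of g] by simp
  from x obtain d where d: "closed d" "x \<epsilon> d" "\<forall>y. y \<epsilon> d \<longrightarrow> good y" unfolding M_def by blast
  have "is_set (\<lambda>y. \<exists>w. w \<epsilon> d \<and> y = act g w)" by (intro is_set_image definable_intros)
  then obtain e where e: "\<And>y. y \<epsilon> e \<longleftrightarrow> (\<exists>w. w \<epsilon> d \<and> y = act g w)" unfolding is_set_def by blast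
  have "closed e" using closed_act_image[OF d(1)] e by blast
  moreover have "good y" if "y \<epsilon> e" for y
    using that d good_act unfolding e obj_def by blast
  ultimately show ?thesis using ne d(2) e unfolding M_def by blast
qed

lemma M_not_node: "x \<in> M \<Longrightarrow> \<not> is_node x \<Longrightarrow> emp \<epsilon> x \<and> \<not> (\<exists>t. is_node t \<and> (\<forall>u. E u t \<longleftrightarrow> E u x))"
  using M_good[of x] unfolding good_def M_def by blast

text \<open>Two nodes are separated by their children, two marked sets by Extensionality in the
  ground model, and the mixed case is excluded by the last clause of \<open>good\<close>.\<close>

lemma M_extensionality:
  assumes "x \<in> M" "y \<in> M" "\<And>z. E z x \<longleftrightarrow> E z y"
  shows "x = y"
proof (cases "is_node x"; cases "is_node y")
  assume "is_node x" "is_node y"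
  then show ?thesis using child_inject assms(3) E_node by blast
next
  assume "\<not> is_node x" "\<not> is_node y"
  then show ?thesis using M_not_node assms E_marked extensionality by metis
qed (use M_not_node assms in blast)+

section \<open>Satisfaction in the model: definability and symmetry\<close>

text \<open>A schema: the induction runs over external formulas, and each \<open>p\<close> receives
  its own definition, its relativization to \<open>M\<close>. No uniform truth definition is
  claimed.\<close>

lemma definable_sat: "definable (\<lambda>s. sat M E s p)"
proof (induction p)
  case (All p)
  have "definable (\<lambda>s. \<forall>a. a \<in> M \<longrightarrow> sat M E (case_nat a s) p)"
    by (intro definable_intros) (simp add: case_nat_Suc_eta All)
  then show ?case by (simp add: Ball_def)
qed (auto intro!: definable_intros)

lemma definable_sat_params:
  "definable (\<lambda>t. sat M E (case_nat (t 0) (case_nat a s)) p)"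
  "definable (\<lambda>t. sat M E (case_nat (t (Suc 0)) (case_nat (t 0) s)) p)"
proof -
  have "definable (\<lambda>t. sat M E (\<lambda>k. if k = 0 then t 0 else case_nat a s (k - 1)) p)"
    by (rule definable_instantiate[OF definable_sat])
  moreover have "(\<lambda>k. if k = 0 then t 0 else case_nat a s (k - 1)) = case_nat (t 0) (case_nat a s)" for t :: "nat \<Rightarrow> 'a"
    by (rule ext) (auto split: nat.split)
  ultimately show "definable (\<lambda>t. sat M E (case_nat (t 0) (case_nat a s)) p)" by (simp only:)
  have "definable (\<lambda>t. sat M E (\<lambda>k. if k < 2 then t (Suc 0 - k) else s (k - Suc (Suc 0))) p)"
    by (rule definable_instantiate[OF definable_sat])
  moreover have "(\<lambda>k. if k < 2 then t (Suc 0 - k) else s (k - Suc (Suc 0))) = case_nat (t (Suc 0)) (case_nat (t 0) s)" for t :: "nat \<Rightarrow> 'a"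
    by (rule ext) (auto simp: less_2_cases_iff numeral_2_eq_2 split: nat.split)
  ultimately show "definable (\<lambda>t. sat M E (case_nat (t (Suc 0)) (case_nat (t 0) s)) p)" by (simp only:)
qed

lemma sat_act:
  assumes "range s \<subseteq> M"
  shows "sat M E (\<lambda>k. act g (s k)) p \<longleftrightarrow> sat M E s p"
proof -
  have "act g ` M = M"
  proof
    show "act g ` M \<subseteq> M" using M_act by blast
    show "M \<subseteq> act g ` M" using M_act act_act M_obj by (metis image_eqI subsetI)
  qed
  moreover have "inj_on (act g) M" by (rule inj_onI) (use act_inject M_obj in blast)
  ultimately show ?thesis
    using sat_image_iso[where f = "act g" and M = M and E = E and E' = E, OF _ _ assms, of p] E_act M_obj by simp
qed

text \<open>An infinite assignment may have no common support, so only an initial segment is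
  covered, of a length \<open>n\<close> that is an external number.\<close>

lemma supports_common:
  fixes s :: "nat \<Rightarrow> 'a"
  assumes "range s \<subseteq> M"
  shows "\<exists>m. m \<epsilon> omega \<and> (\<forall>k<n. supports (L m) (s k))"
proof (induction n)
  case 0
  then show ?case using emp_omega by blast
next
  case (Suc n)
  then obtain m where m: "m \<epsilon> omega" "\<forall>k<n. supports (L m) (s k)" by blast
  have "s n \<in> M" using assms by auto
  then obtain l where l: "l \<epsilon> omega" "supports (L l) (s n)" using M_symm unfolding symm_def by blast
  obtain j where "j \<epsilon> omega" "m \<sqsubseteq> j" "l \<sqsubseteq> j" using omega_bound2 m(1) l(1) by blast
  then show ?case using m(2) l(2) supports_mono L_mono less_Suc_eq by metis
qed

text \<open>Only the finitely many parameters free in \<open>p\<close> have to be fixed; beyond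
  that, the flips fixing them are automorphisms and preserve truth. The first two variables stay
  free for an argument and a value.\<close>

lemma sat_symm:
  assumes "range s \<subseteq> M"
  shows "\<exists>m. m \<epsilon> omega \<and> (\<forall>g x y. (\<forall>z. z \<epsilon> g \<longrightarrow> \<not> z \<epsilon> L m) \<longrightarrow> x \<in> M \<longrightarrow> y \<in> M \<longrightarrow>
    sat M E (case_nat y (case_nat x s)) p \<longrightarrow> sat M E (case_nat (act g y) (case_nat (act g x) s)) p)"
proof -
  obtain n where n: "\<forall>k\<in>fv p. k < n" using fv_bounded by blast
  obtain m where m: "m \<epsilon> omega" "\<forall>k<n. supports (L m) (s k)" using supports_common[OF assms] by blast
  have "sat M E (case_nat (act g y) (case_nat (act g x) s)) p"
    if g: "\<forall>z. z \<epsilon> g \<longrightarrow> \<not> z \<epsilon> L m" and "x \<in> M" "y \<in> M"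
      and sat: "sat M E (case_nat y (case_nat x s)) p" for g x y
  proof -
    have "range (case_nat y (case_nat x s)) \<subseteq> M" using assms that(2,3) by (intro range_case_nat)
    then have "sat M E (\<lambda>k. act g (case_nat y (case_nat x s) k)) p" using sat by (simp only: sat_act)
    moreover have "sat M E (\<lambda>k. act g (case_nat y (case_nat x s) k)) p \<longleftrightarrow>
        sat M E (case_nat (act g y) (case_nat (act g x) s)) p"
    proof (rule sat_cong_fv)
      fix k assume k: "k \<in> fv p"
      have *: "act g (s l) = s l" if "l < n" for l
        by (rule supportsD[of "L m"]) (use m(2) g that in auto)
      have "k < n" using n k by blast
      then show "act g (case_nat y (case_nat x s) k) = case_nat (act g y) (case_nat (act g x) s) k"
        using * by (auto split: nat.split)
    qed
    ultimately show ?thesis by blast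
  qed
  then show ?thesis using m(1) by blast
qed

section \<open>The axioms in the model\<close>

text \<open>One \<open>m\<close> above a prescribed \<open>l\<close> serves \<open>a\<close>, its
  members and the parameters behind \<open>l\<close> at the same time.\<close>

lemma M_bounds:
  assumes "a \<in> M" "l \<epsilon> omega"
  obtains m i where "m \<epsilon> omega" "bit i" "l \<sqsubseteq> m" "supports (L m) a"
    "\<And>u. E u a \<Longrightarrow> supports (un (L m) (col i)) u"
proof -
  obtain m1 where m1: "m1 \<epsilon> omega" "supports (L m1) a" using M_symm[OF assms(1)] unfolding symm_def by blast
  obtain m2 i where m2: "m2 \<epsilon> omega" "bit i" "\<And>u. E u a \<Longrightarrow> supports (un (L m2) (col i)) u"
    using M_small[OF assms(1)] unfolding small_def by blast
  obtain m3 where m3: "m3 \<epsilon> omega" "l \<sqsubseteq> m3" "m1 \<sqsubseteq> m3" using omega_bound2[OF assms(2) m1(1)] by blast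
  obtain m where m: "m \<epsilon> omega" "m3 \<sqsubseteq> m" "m2 \<sqsubseteq> m" using omega_bound2[OF m3(1) m2(1)] by blast
  have "un (L m2) (col i) \<sqsubseteq> un (L m) (col i)" using L_mono[OF m(3)] unfolding sub_def by auto
  moreover have "l \<sqsubseteq> m" "m1 \<sqsubseteq> m" using m3 m unfolding sub_def by auto
  ultimately show thesis using that m(1) m2 m1(2) supports_mono L_mono by metis
qed

lemma M_Comprehension:
  assumes "range s \<subseteq> M" "a \<in> M"
  shows "\<exists>b\<in>M. \<forall>x. E x b \<longleftrightarrow> E x a \<and> sat M E (case_nat x (case_nat a s)) p"
proof -
  \<comment> \<open>The set \<open>a\<close> will take the place of \<open>x\<close> and the element
    the place of \<open>y\<close>.\<close>
  obtain l where l: "l \<epsilon> omega" "\<And>g x y. (\<forall>z. z \<epsilon> g \<longrightarrow> \<not> z \<epsilon> L l) \<Longrightarrow> x \<in> M \<Longrightarrow> y \<in> M \<Longrightarrow>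
    sat M E (case_nat y (case_nat x s)) p \<Longrightarrow> sat M E (case_nat (act g y) (case_nat (act g x) s)) p"
    using sat_symm[OF assms(1)] by blast
  obtain m i where m: "m \<epsilon> omega" "bit i" "l \<sqsubseteq> m" "supports (L m) a"
    "\<And>u. E u a \<Longrightarrow> supports (un (L m) (col i)) u"
    using M_bounds[OF assms(2) l(1)] by blast
  show ?thesis
  proof (rule ex_M_extension[OF _ _ m(1) _ m(1,2)])
    have "definable (\<lambda>t. sat M E (case_nat (t 0) (case_nat a s)) p)"
      by (rule definable_sat_params)
    then have "is_set (\<lambda>x. x \<epsilon> coll (\<lambda>x. E x a) \<and> sat M E (case_nat x (case_nat a s)) p)"
      by (rule is_set_separation)
    then show "is_set (\<lambda>x. E x a \<and> sat M E (case_nat x (case_nat a s)) p)"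
      by (simp add: mem_coll[OF is_set_E])
    fix u assume u: "E u a \<and> sat M E (case_nat u (case_nat a s)) p"
    then show "u \<in> M" using E_M assms(2) by blast
    show "supports (un (L m) (col i)) u" using m(5) u by blast
    fix g assume g: "\<And>z. z \<epsilon> g \<Longrightarrow> \<not> z \<epsilon> L m"
    then have "\<forall>z. z \<epsilon> g \<longrightarrow> \<not> z \<epsilon> L l" using L_mono[OF m(3)] unfolding sub_def by blast
    moreover have "act g a = a" using supportsD[OF m(4)] g by blast
    ultimately show "E (act g u) a \<and> sat M E (case_nat (act g u) (case_nat a s)) p"
      using l(2)[of g a u] u E_act[of u a g] M_obj assms(2) \<open>u \<in> M\<close> by metis
  qed
qed

text \<open>If a flip fixes the argument and the parameters, it sends a value to a value for the
  same argument, hence to itself. So values inherit the support of their arguments, and no second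
  column enters.\<close>

lemma M_Replacement:
  assumes "range s \<subseteq> M" "a \<in> M"
    and single: "\<And>x y z. E x a \<Longrightarrow> y \<in> M \<Longrightarrow> z \<in> M \<Longrightarrow> sat M E (case_nat y (case_nat x s)) p \<Longrightarrow>
      sat M E (case_nat z (case_nat x s)) p \<Longrightarrow> y = z"
  shows "\<exists>b\<in>M. \<forall>y. E y b \<longleftrightarrow> (\<exists>x. E x a \<and> y \<in> M \<and> sat M E (case_nat y (case_nat x s)) p)"
proof -
  obtain l where l: "l \<epsilon> omega" "\<And>g x y. (\<forall>z. z \<epsilon> g \<longrightarrow> \<not> z \<epsilon> L l) \<Longrightarrow> x \<in> M \<Longrightarrow> y \<in> M \<Longrightarrow>
    sat M E (case_nat y (case_nat x s)) p \<Longrightarrow> sat M E (case_nat (act g y) (case_nat (act g x) s)) p"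
    using sat_symm[OF assms(1)] by blast
  obtain m i where m: "m \<epsilon> omega" "bit i" "l \<sqsubseteq> m" "supports (L m) a"
    "\<And>u. E u a \<Longrightarrow> supports (un (L m) (col i)) u"
    using M_bounds[OF assms(2) l(1)] by blast
  have sub: "\<forall>z. z \<epsilon> g \<longrightarrow> \<not> z \<epsilon> L l" if "\<And>z. z \<epsilon> g \<Longrightarrow> \<not> z \<epsilon> L m" for g
    using L_mono[OF m(3)] that unfolding sub_def by blast
  show ?thesis
  proof (rule ex_M_extension[OF _ _ m(1) _ m(1,2)])
    have "definable (\<lambda>t. sat M E (case_nat (t (Suc 0)) (case_nat (t 0) s)) p)"
      by (rule definable_sat_params)
    then have "is_set (\<lambda>y. \<exists>x. x \<epsilon> coll (\<lambda>x. E x a) \<and> y \<in> M \<and> sat M E (case_nat y (case_nat x s)) p)"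
      by (intro is_set_replacement definable_intros) (use single in \<open>auto simp: mem_coll[OF is_set_E]\<close>)
    then show "is_set (\<lambda>y. \<exists>x. E x a \<and> y \<in> M \<and> sat M E (case_nat y (case_nat x s)) p)"
      by (simp add: mem_coll[OF is_set_E])
    fix y assume "\<exists>x. E x a \<and> y \<in> M \<and> sat M E (case_nat y (case_nat x s)) p"
    then obtain x where x: "E x a" "y \<in> M" "sat M E (case_nat y (case_nat x s)) p" by blast
    have "x \<in> M" using E_M assms(2) x(1) by blast
    show "y \<in> M" by fact
    show "supports (un (L m) (col i)) y"
      unfolding supports_def
    proof (intro allI impI)
      fix g assume g: "\<forall>z. z \<epsilon> g \<longrightarrow> \<not> z \<epsilon> un (L m) (col i)"
      then have "act g x = x" using supportsD[OF m(5)[OF x(1)]] by blast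
      then have "sat M E (case_nat (act g y) (case_nat x s)) p"
        using l(2)[OF sub \<open>x \<in> M\<close> x(2,3), of g] g by simp
      then show "act g y = y" using single x M_act by blast
    qed
    fix g assume g: "\<And>z. z \<epsilon> g \<Longrightarrow> \<not> z \<epsilon> L m"
    then have "sat M E (case_nat (act g y) (case_nat (act g x) s)) p"
      using l(2)[OF sub \<open>x \<in> M\<close> x(2,3)] by blast
    moreover have "E (act g x) a"
      using supportsD[OF m(4), of g] g E_act[of x a g] x(1) M_obj \<open>x \<in> M\<close> assms(2) by metis
    ultimately show "\<exists>x. E x a \<and> act g y \<in> M \<and> sat M E (case_nat (act g y) (case_nat x s)) p"
      using M_act x(2) by blast
  qed
qed

lemma M_Pairing:
  assumes "x \<in> M" "y \<in> M"
  shows "\<exists>z\<in>M. \<forall>w. E w z \<longleftrightarrow> w = x \<or> w = y"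
proof -
  obtain l where l: "l \<epsilon> omega" "supports (L l) x" using M_symm[OF assms(1)] unfolding symm_def by blast
  obtain m where m: "m \<epsilon> omega" "l \<sqsubseteq> m" "supports (L m) y" using M_bounds[OF assms(2) l(1)] by blast
  have x: "supports (L m) x" using supports_mono[OF l(2) L_mono[OF m(2)]] .
  show ?thesis
  proof (rule ex_M_extension[OF is_set_upair _ m(1) _ m(1)])
    \<comment> \<open>Both elements are supported by \<open>L m\<close> alone, so the colour is a
      free choice.\<close>
    show "bit emp" by (simp add: bit_def)
    fix u assume u: "u = x \<or> u = y"
    then show "u \<in> M" using assms by blast
    have "supports (L m) u" using u x m(3) by blast
    then show "supports (un (L m) (col emp)) u" by (rule supports_mono) (simp add: sub_def)
    fix g assume "\<And>z. z \<epsilon> g \<Longrightarrow> \<not> z \<epsilon> L m"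
    then have "act g u = u" using supportsD[OF \<open>supports (L m) u\<close>] by blast
    then show "act g u = x \<or> act g u = y" using u by simp
  qed
qed

text \<open>A flip that fixes every member of \<open>a\<close> fixes every subset of
  \<open>a\<close>. Thus the bound witnessing smallness of \<open>a\<close> supports each of its
  subsets and makes the power set small.\<close>

lemma M_Power_Set:
  assumes "a \<in> M"
  shows "\<exists>P\<in>M. \<forall>y. E y P \<longleftrightarrow> y \<in> M \<and> (\<forall>z. E z y \<longrightarrow> E z a)"
proof -
  obtain m i where m: "m \<epsilon> omega" "bit i" "supports (L m) a"
    "\<And>u. E u a \<Longrightarrow> supports (un (L m) (col i)) u"
    using M_bounds[OF assms emp_omega] by blast
  show ?thesis
  proof (rule ex_M_extension[OF _ _ m(1) _ m(1,2)])
    \<comment> \<open>A subset in the model is determined by its extension, which ranges over a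
      power set of the ground model, so Replacement applies.\<close>
    have "is_set (\<lambda>y. \<exists>e. e \<epsilon> pow (coll (\<lambda>u. E u a)) \<and> y \<in> M \<and> (\<forall>z. E z y \<longleftrightarrow> z \<epsilon> e))"
      by (rule is_set_replacement) (auto intro!: definable_intros M_extensionality)
    moreover have "(\<exists>e. e \<epsilon> pow (coll (\<lambda>u. E u a)) \<and> y \<in> M \<and> (\<forall>z. E z y \<longleftrightarrow> z \<epsilon> e)) \<longleftrightarrow>
        y \<in> M \<and> (\<forall>z. E z y \<longrightarrow> E z a)" for y
      unfolding mem_pow sub_def mem_coll[OF is_set_E]
      using mem_coll[OF is_set_E[of y]] by (auto intro!: exI[of _ "coll (\<lambda>u. E u y)"])
    ultimately show "is_set (\<lambda>y. y \<in> M \<and> (\<forall>z. E z y \<longrightarrow> E z a))" by simp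
    fix y assume y: "y \<in> M \<and> (\<forall>z. E z y \<longrightarrow> E z a)"
    then show "y \<in> M" by blast
    have E_swap: "E z (act g y) \<longleftrightarrow> E (act g z) y" if "obj z" for z g
      using E_act[of "act g z" y g] act_act obj_act M_obj y that by metis
    show "supports (un (L m) (col i)) y"
      unfolding supports_def
    proof (intro allI impI)
      fix g assume g: "\<forall>z. z \<epsilon> g \<longrightarrow> \<not> z \<epsilon> un (L m) (col i)"
      have fix_z: "act g z = z" if "E z y" for z
        using supportsD[OF m(4), of z g] g y that by blast
      have "E z (act g y) \<longleftrightarrow> E z y" for z
      proof
        assume z: "E z (act g y)"
        then have "obj z" using obj_E obj_act M_obj y by blast
        then have "E (act g z) y" using E_swap z by blast
        moreover from this have "act g (act g z) = act g z" using fix_z by blast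
        ultimately show "E z y" using act_act[OF \<open>obj z\<close>] by simp
      next
        assume z: "E z y"
        then have "obj z" using obj_E M_obj y by blast
        then show "E z (act g y)" using E_swap z fix_z by simp
      qed
      then show "act g y = y" using M_extensionality M_act y by blast
    qed
    fix g assume "\<And>z. z \<epsilon> g \<Longrightarrow> \<not> z \<epsilon> L m"
    then have a: "act g a = a" using supportsD[OF m(3)] by blast
    have "E z a" if z: "E z (act g y)" for z
    proof -
      have "obj z" using z obj_E obj_act M_obj y by blast
      then have "E (act g z) a" using E_swap z y by blast
      then have "E (act g (act g z)) (act g a)" using E_act obj_act M_obj assms \<open>obj z\<close> by blast
      then show ?thesis using a act_act[OF \<open>obj z\<close>] by simp
    qed
    then show "act g y \<in> M \<and> (\<forall>z. E z (act g y) \<longrightarrow> E z a)" using M_act y by blast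
  qed
qed

text \<open>Without a minimal member, a set containing a node would contain nodes of unboundedly
  high level. Beyond level \<open>m0\<close> their areas contain both colours at height
  \<open>m0\<close>, which smallness forbids.\<close>

lemma M_Foundation:
  assumes "x \<in> M" "E y x"
  shows "\<exists>y. E y x \<and> \<not> (\<exists>z. E z x \<and> E z y)"
proof (rule ccontr)
  assume "\<not> ?thesis"
  then have descend: "\<exists>z. E z x \<and> E z y" if "E y x" for y using that by blast
  show False
  proof (cases "\<exists>k m p. is_node (node k m p) \<and> E (node k m p) x")
    case True
    obtain m0 i where m0: "m0 \<epsilon> omega" "bit i" "\<And>u. E u x \<Longrightarrow> supports (un (L m0) (col i)) u"
      using M_small[OF assms(1)] unfolding small_def by blast
    define N where "N m \<longleftrightarrow> m \<epsilon> omega \<and> (\<exists>k p. is_node (node k m p) \<and> E (node k m p) x)" for m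
    have N_succ: "N (succ m)" if m: "N m" for m
    proof -
      obtain k p where kp: "is_node (node k m p)" "E (node k m p) x" using m unfolding N_def by blast
      obtain z where z: "E z x" "E z (node k m p)" using descend kp(2) by blast
      then have "child z (node k m p)" using kp(1) E_node by blast
      moreover from this obtain q where "z = node k (succ m) q" unfolding child_def by auto
      ultimately have "is_node (node k (succ m) q)" "z = node k (succ m) q" using child_is_node by blast+
      then show ?thesis using z(1) m unfolding N_def by auto
    qed
    obtain m1 where m1: "N m1" using True unfolding N_def is_node_def by auto
    \<comment> \<open>Induction within \<open>omega\<close>, as \<open>m0\<close> may be nonstandard
      and out of reach of external iteration.\<close>
    have "\<exists>m. N m \<and> n \<epsilon> m" if "n \<epsilon> omega" for n
      using that
    proof (induction n rule: omega_induct)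
      case definable
      show ?case unfolding N_def by (intro definable_intros)
    next
      case emp
      then show ?case using N_succ[OF m1] emp_mem_succ m1 unfolding N_def by blast
    next
      case (succ n)
      then obtain m where "N m" "n \<epsilon> m" by blast
      then show ?case using N_succ succ_mem_succ unfolding N_def by blast
    qed
    then obtain m where m: "N m" "m0 \<epsilon> m" using m0(1) by blast
    then obtain k p where kp: "is_node (node k m p)" "E (node k m p) x" unfolding N_def by blast
    then have sub: "area k m \<sqsubseteq> un (L m0) (col i)" using m0(3) supports_node_iff by blast
    \<comment> \<open>With the other colour, \<open>pr m0 j\<close> is outside \<open>col i\<close>,
      and it is outside \<open>L m0\<close> because \<open>m0\<close> is not an element of
      itself.\<close>
    obtain j where j: "bit j" "j \<noteq> i" using m0(2) unfolding bit_def by (metis emp_neq_one(1))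
    have "pr m0 j \<epsilon> area k m" unfolding mem_area mem_L using m(2) j(1) by blast
    then have "pr m0 j \<epsilon> un (L m0) (col i)" using sub unfolding sub_def by blast
    then show False using j(2) not_mem_self unfolding mem_un mem_L mem_col by auto
  next
    case False
    \<comment> \<open>When no member of \<open>x\<close> is a node, \<open>E\<close> below these
      members is ground membership, and Foundation of the ground model applies.\<close>
    have "y \<epsilon> coll (\<lambda>u. E u x)" using assms(2) by (simp add: mem_coll[OF is_set_E])
    then obtain u where u: "E u x" "\<And>z. E z x \<Longrightarrow> \<not> z \<epsilon> u"
      using foundation[of y "coll (\<lambda>u. E u x)"] unfolding mem_coll[OF is_set_E] by blast
    have "\<not> is_node u" using False u(1) unfolding is_node_def by blast
    then show False using descend[OF u(1)] u(2) child_is_node unfolding E_def by blast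
  qed
qed

text \<open>A building step for sets free of nodes: every flip fixes them, so empty supports
  suffice, and they cannot share their members with a node, whose members are nodes.\<close>

lemma M_pure:
  assumes "emp \<epsilon> x" "\<And>u. u \<epsilon> x \<Longrightarrow> u = emp \<or> u \<in> M \<and> emp \<epsilon> u \<and> (\<forall>g. act g u = u)"
  shows "x \<in> M \<and> emp \<epsilon> x \<and> (\<forall>g. act g x = x)"
proof -
  have "obj x" by (rule objI[OF assms(1)]) (use assms(2) M_obj in blast)
  have fixed: "act g u = u" if "u \<epsilon> x" for u g using assms(2)[OF that] by auto
  have act_x: "act g x = x" for g
    using mem_act[OF \<open>obj x\<close> not_node_marked[OF assms(1)]] fixed by (intro extensionality) metis
  moreover have "x \<in> M"
  proof (rule MI[OF assms(1)])
    show "u \<in> M" if "u \<epsilon> x" "u \<noteq> emp" for u using assms(2) that by blast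
    show "symm x" unfolding symm_def supports_def using act_x emp_omega by blast
    show "small x" unfolding small_def supports_def E_marked[OF assms(1)] bit_def
      using fixed emp_omega by blast
    show "\<not> (\<exists>t. is_node t \<and> (\<forall>u. E u t \<longleftrightarrow> E u x))"
    proof
      assume "\<exists>t. is_node t \<and> (\<forall>u. E u t \<longleftrightarrow> E u x)"
      then obtain t u where "child u t" "E u x" using ex_child E_node by metis
      then show False using assms(2) child_is_node not_node_marked unfolding E_marked[OF assms(1)] by blast
    qed
  qed
  ultimately show ?thesis using assms(1) by blast
qed

lemma omega_pure: "n \<epsilon> omega \<Longrightarrow> n = emp \<or> n \<in> M \<and> emp \<epsilon> n \<and> (\<forall>g. act g n = n)"
proof -
  assume "n \<epsilon> omega"
  \<comment> \<open>All elements of \<open>succ n\<close> are treated together, because the step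
    needs the claim for every member of the next number.\<close>
  then have "\<forall>u. u \<epsilon> succ n \<longrightarrow> u = emp \<or> u \<in> M \<and> emp \<epsilon> u \<and> (\<forall>g. act g u = u)"
  proof (induction n rule: omega_induct)
    case definable
    show ?case by (intro definable_intros)
  next
    case emp
    then show ?case by simp
  next
    case (succ n)
    have "succ n \<in> M \<and> emp \<epsilon> succ n \<and> (\<forall>g. act g (succ n) = succ n)"
      by (rule M_pure) (use succ emp_mem_succ in blast)+
    then show ?case using succ.IH unfolding mem_succ[of _ "succ n"] by blast
  qed
  then show ?thesis by simp
qed

text \<open>The witness is \<open>omega\<close> itself. Its element \<open>emp\<close> acts as the
  marker, so counting starts at \<open>succ emp\<close> and every number is shifted by one.\<close>

lemma M_Infinity:
  "\<exists>I\<in>M. (\<exists>z\<in>M. E z I \<and> (\<forall>w\<in>M. \<not> E w z)) \<and>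
     (\<forall>y\<in>M. E y I \<longrightarrow> (\<exists>z\<in>M. E z I \<and> (\<forall>w\<in>M. E w z \<longleftrightarrow> E w y \<or> w = y)))"
proof (rule bexI[of _ omega], intro conjI ballI impI)
  show omega: "omega \<in> M" using M_pure[OF emp_omega] omega_pure by blast
  have E_omega: "E n omega \<longleftrightarrow> n \<epsilon> omega \<and> n \<noteq> emp" for n using E_marked[OF emp_omega] .
  have succ_E: "E (succ n) omega" if "n \<epsilon> omega" for n
    unfolding E_omega using that succ_omega mem_succ[of n n] by (metis mem_emp)
  have E_succ: "E w (succ n) \<longleftrightarrow> (w \<epsilon> n \<or> w = n) \<and> w \<noteq> emp" if "n \<epsilon> omega" for w n
    using E_marked[OF emp_mem_succ[OF that], of w] by simp
  have "\<not> E w (succ emp)" for w using E_succ[OF emp_omega] by simp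
  then show "\<exists>z\<in>M. E z omega \<and> (\<forall>w\<in>M. \<not> E w z)" using succ_E[OF emp_omega] E_M[OF omega] by blast
  fix y assume "y \<in> M" "E y omega"
  then have y: "y \<epsilon> omega" "y \<noteq> emp" unfolding E_omega by auto
  then have "emp \<epsilon> y" using omega_pure by blast
  have "E w (succ y) \<longleftrightarrow> E w y \<or> w = y" for w
    unfolding E_succ[OF y(1)] E_marked[OF \<open>emp \<epsilon> y\<close>] using y(2) by auto
  then show "\<exists>z\<in>M. E z omega \<and> (\<forall>w\<in>M. E w z \<longleftrightarrow> E w y \<or> w = y)"
    using succ_E[OF y(1)] E_M[OF omega] by blast
qed

lemma M_model: "is_model M E ZF_minus_Union"
  unfolding is_model_ZF_minus_Union_iff
proof (intro conjI allI impI)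
  show "M \<noteq> {}" using M_Infinity by blast
  have "sat M E s Extensionality" for s
    unfolding sat_Extensionality using M_extensionality E_M by blast
  moreover have "sat M E s Foundation" for s
    unfolding sat_Foundation
  proof (intro ballI impI)
    fix x assume x: "x \<in> M" "\<exists>y\<in>M. E y x"
    then obtain y where "E y x" "\<not> (\<exists>z. E z x \<and> E z y)" using M_Foundation[OF x(1)] by metis
    then show "\<exists>y\<in>M. E y x \<and> \<not> (\<exists>z\<in>M. E z x \<and> E z y)" using E_M x(1) by blast
  qed
  moreover have "sat M E s Pairing" for s
    unfolding sat_Pairing
  proof (intro ballI)
    fix x y assume "x \<in> M" "y \<in> M"
    from M_Pairing[OF this] show "\<exists>z\<in>M. \<forall>w\<in>M. E w z \<longleftrightarrow> w = x \<or> w = y" by blast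
  qed
  moreover have "sat M E s Power_Set" for s
    unfolding sat_Power_Set
  proof
    fix x assume "x \<in> M"
    then obtain P where P: "P \<in> M" "\<And>y. E y P \<longleftrightarrow> y \<in> M \<and> (\<forall>z. E z y \<longrightarrow> E z x)"
      using M_Power_Set by blast
    have "\<forall>y\<in>M. E y P \<longleftrightarrow> (\<forall>z\<in>M. E z y \<longrightarrow> E z x)" unfolding P(2) using E_M by blast
    then show "\<exists>P\<in>M. \<forall>y\<in>M. E y P \<longleftrightarrow> (\<forall>z\<in>M. E z y \<longrightarrow> E z x)" using P(1) by blast
  qed
  moreover have "sat M E s Infinity" for s
    unfolding sat_Infinity by (rule M_Infinity)
  ultimately show "\<forall>p\<in>{Extensionality, Foundation, Pairing, Power_Set, Infinity}.
      \<forall>s. range s \<subseteq> M \<longrightarrow> sat M E s p" by simp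
next
  fix p and s :: "nat \<Rightarrow> 'a" assume s: "range s \<subseteq> M"
  show "sat M E s (Comprehension_body p)"
    unfolding sat_Comprehension_body
  proof
    fix a assume "a \<in> M"
    from M_Comprehension[OF s this, of p]
    show "\<exists>b\<in>M. \<forall>x\<in>M. E x b \<longleftrightarrow> E x a \<and> sat M E (case_nat x (case_nat a s)) p" by blast
  qed
next
  fix p and s :: "nat \<Rightarrow> 'a" assume s: "range s \<subseteq> M"
  show "sat M E s (Replacement_body p)"
    unfolding sat_Replacement_body
  proof (intro ballI impI)
    fix a assume a: "a \<in> M"
    let ?R = "\<lambda>x y. sat M E (case_nat y (case_nat x (case_nat a s))) p"
    assume single: "\<forall>x\<in>M. E x a \<longrightarrow> (\<forall>y\<in>M. \<forall>z\<in>M. ?R x y \<and> ?R x z \<longrightarrow> y = z)"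
    have "\<exists>b\<in>M. \<forall>y. E y b \<longleftrightarrow> (\<exists>x. E x a \<and> y \<in> M \<and> ?R x y)"
      by (rule M_Replacement[OF range_case_nat[OF a s] a]) (use single E_M[OF a] in blast)
    then show "\<exists>b\<in>M. \<forall>y\<in>M. E y b \<longleftrightarrow> (\<exists>x\<in>M. E x a \<and> ?R x y)" using E_M[OF a] by blast
  qed
qed

section \<open>Two sets without a union\<close>

text \<open>The area of a root is just its label, so the roots with labels in one column are
  uniformly supported by that column. Flips change \<open>p\<close> but never a label, so the row is
  invariant.\<close>

lemma M_row:
  assumes "bit i"
  shows "\<exists>x\<in>M. \<forall>u. E u x \<longleftrightarrow> (\<exists>k p. k \<epsilon> col i \<and> p \<sqsubseteq> area k emp \<and> u = node k emp p)"
proof (rule ex_M_extension[OF _ _ emp_omega _ emp_omega assms])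
  let ?X = "\<lambda>u. \<exists>k p. k \<epsilon> col i \<and> p \<sqsubseteq> area k emp \<and> u = node k emp p"
  have area: "area k emp = upair k k" for k by (rule extensionality) (simp add: mem_area mem_L)
  have sub: "p \<sqsubseteq> upair k k \<longleftrightarrow> p = emp \<or> p = upair k k" for p k
    using extensionality[of p "upair k k"] emp_iff[of p] by (auto simp: sub_def)
  \<comment> \<open>Each label carries exactly two roots, which presents the row as a union of two
    images of the column.\<close>
  have "?X = (\<lambda>u. (\<exists>k. k \<epsilon> col i \<and> u = node k emp emp) \<or> (\<exists>k. k \<epsilon> col i \<and> u = node k emp (upair k k)))"
    unfolding area sub by (intro ext) blast
  moreover have "is_set \<dots>" by (intro is_set_disj is_set_image definable_intros)
  ultimately show "is_set ?X" by simp
  fix u assume "?X u"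
  then obtain k p where u: "k \<epsilon> col i" "p \<sqsubseteq> area k emp" "u = node k emp p" by blast
  have "k \<epsilon> L omega" using u(1) assms unfolding mem_col mem_L by blast
  then have node: "is_node u" using u(2,3) emp_omega unfolding is_node_def by blast
  then show "u \<in> M" by (rule node_M)
  have "area k emp \<sqsubseteq> un (L emp) (col i)" using u(1) unfolding area sub_def by simp
  then show "supports (un (L emp) (col i)) u" using supports_node_iff node u(3) by blast
  fix g
  have "act g u = node k emp (symdiff p (inter g (area k emp)))"
    using flips_act[OF node, of g] u(3) unfolding flips_def by auto
  moreover have "symdiff p (inter g (area k emp)) \<sqsubseteq> area k emp" using u(2) unfolding sub_def by auto
  ultimately show "?X (act g u)" using u(1) by blast
qed

lemma M_no_union:
  "\<exists>x\<in>M. \<exists>y\<in>M. \<not> (\<exists>z\<in>M. \<forall>w\<in>M. E w z \<longleftrightarrow> E w x \<or> E w y)"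
proof -
  let ?X = "\<lambda>i u. \<exists>k p. k \<epsilon> col i \<and> p \<sqsubseteq> area k emp \<and> u = node k emp p"
  obtain x where x: "x \<in> M" "\<And>u. E u x \<longleftrightarrow> ?X emp u" using M_row[of emp] unfolding bit_def by blast
  obtain y where y: "y \<in> M" "\<And>u. E u y \<longleftrightarrow> ?X one u" using M_row[of one] unfolding bit_def by blast
  have False if z: "z \<in> M" "\<forall>w\<in>M. E w z \<longleftrightarrow> E w x \<or> E w y" for z
  proof -
    obtain m i where m: "m \<epsilon> omega" "bit i" "\<And>u. E u z \<Longrightarrow> supports (un (L m) (col i)) u"
      using M_small[OF z(1)] unfolding small_def by blast
    obtain j where j: "bit j" "j \<noteq> i" using m(2) unfolding bit_def by (metis emp_neq_one(1))
    \<comment> \<open>The root labelled \<open>pr m j\<close> lies in one of the rows, but its label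
      escapes \<open>L m\<close>, as \<open>m\<close> is not in \<open>m\<close>, and also the
      column of the other colour.\<close>
    define k where "k = pr m j"
    define u where "u = node k emp emp"
    have "k \<epsilon> col j" using m(1) unfolding k_def mem_col by blast
    then have "?X j u" unfolding u_def sub_def by auto
    then have "E u x \<or> E u y" using j(1) unfolding x(2) y(2) bit_def by blast
    then have "E u z" using z(2) E_M x(1) y(1) by blast
    have "k \<epsilon> L omega" using m(1) j(1) unfolding k_def mem_L by blast
    then have "is_node u" unfolding is_node_def u_def sub_def by auto
    then have "area k emp \<sqsubseteq> un (L m) (col i)" using m(3)[OF \<open>E u z\<close>] supports_node_iff unfolding u_def by blast
    then have "k \<epsilon> un (L m) (col i)" unfolding sub_def mem_area by blast
    then show False using j(2) not_mem_self unfolding k_def mem_un mem_L mem_col by auto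
  qed
  then show ?thesis using x(1) y(1) by blast
qed

end

section \<open>Unordered pairs are finite\<close>

text \<open>Finiteness is meant in the sense of the structure, so the number two and a bijection
  from it must exist there. Both are obtained by Pairing from the empty set and the two
  elements.\<close>

lemma sat_is_finite_upair:
  assumes model: "is_model M E ZF_minus_Union"
    and mem: "x \<in> M" "y \<in> M" "F \<in> M" and neq: "x \<noteq> y"
    and F: "\<forall>w\<in>M. E w F \<longleftrightarrow> w = x \<or> w = y"
  shows "sat M E (case_nat F s) (is_finite 0)"
proof -
  have "range (\<lambda>_. x) \<subseteq> M" using mem(1) by auto
  then have ax: "sat M E (\<lambda>_. x) p" if "p \<in> {Extensionality, Pairing, Infinity}" for p
    using model that unfolding is_model_ZF_minus_Union_iff by blast
  have ext: "a = b" if "a \<in> M" "b \<in> M" "\<forall>w\<in>M. E w a \<longleftrightarrow> E w b" for a b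
    using ax[of Extensionality] that unfolding sat_Extensionality by blast
  have "\<forall>a\<in>M. \<forall>b\<in>M. \<exists>z. z \<in> M \<and> (\<forall>w\<in>M. E w z \<longleftrightarrow> w = a \<or> w = b)"
    using ax[of Pairing] unfolding sat_Pairing by blast
  then obtain up where up: "\<And>a b. a \<in> M \<Longrightarrow> b \<in> M \<Longrightarrow> up a b \<in> M"
      "\<And>a b w. a \<in> M \<Longrightarrow> b \<in> M \<Longrightarrow> w \<in> M \<Longrightarrow> E w (up a b) \<longleftrightarrow> w = a \<or> w = b"
    by metis
  have up_eq: "z = up a b" if "z \<in> M" "a \<in> M" "b \<in> M" "\<forall>w\<in>M. E w z \<longleftrightarrow> w = a \<or> w = b" for z a b
    using ext[of z "up a b"] up that by simp
  have up_inject: "a = c \<and> b = d \<or> a = d \<and> b = c"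
    if "up a b = up c d" "a \<in> M" "b \<in> M" "c \<in> M" "d \<in> M" for a b c d
    using up(2)[of a b] up(2)[of c d] that by metis
  define op where "op p a b \<longleftrightarrow> (\<exists>u\<in>M. \<exists>v\<in>M. (\<forall>w\<in>M. E w u \<longleftrightarrow> w = a) \<and>
     (\<forall>w\<in>M. E w v \<longleftrightarrow> w = a \<or> w = b) \<and> (\<forall>w\<in>M. E w p \<longleftrightarrow> w = u \<or> w = v))" for p a b
  define kp where "kp a b = up (up a a) (up a b)" for a b
  have kp: "kp a b \<in> M" if "a \<in> M" "b \<in> M" for a b unfolding kp_def using up(1) that by blast
  have kp_inject: "a = c \<and> b = d" if "kp a b = kp c d" "a \<in> M" "b \<in> M" "c \<in> M" "d \<in> M" for a b c d
  proof -
    have "up a a = up c c \<and> up a b = up c d \<or> up a a = up c d \<and> up a b = up c c"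
      using that up(1) unfolding kp_def by (intro up_inject) auto
    then show ?thesis using up_inject that(2-5) by metis
  qed
  have op_iff: "op p a b \<longleftrightarrow> p = kp a b" if "p \<in> M" "a \<in> M" "b \<in> M" for p a b
  proof
    assume "op p a b"
    then obtain u v where uv: "u \<in> M" "v \<in> M" "\<forall>w\<in>M. E w u \<longleftrightarrow> w = a \<or> w = a"
      "\<forall>w\<in>M. E w v \<longleftrightarrow> w = a \<or> w = b" "\<forall>w\<in>M. E w p \<longleftrightarrow> w = u \<or> w = v"
      unfolding op_def by auto
    have "u = up a a" "v = up a b" using up_eq uv that by blast+
    then show "p = kp a b" unfolding kp_def using up_eq[of p u v] uv that by blast
  next
    assume "p = kp a b"
    then show "op p a b" unfolding op_def kp_def
      using that up by (intro bexI[of _ "up a a"] bexI[of _ "up a b"]) auto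
  qed
  obtain e where e: "e \<in> M" "\<forall>w\<in>M. \<not> E w e"
    using ax[of Infinity] unfolding sat_Infinity by blast
  \<comment> \<open>Zero, one and two are \<open>e\<close>, \<open>i\<close> and \<open>t\<close>;
    the bijection \<open>f\<close> sends \<open>e\<close> to \<open>x\<close> and \<open>i\<close>
    to \<open>y\<close>.\<close>
  define i where "i = up e e"
  define t where "t = up e i"
  define f where "f = up (kp e x) (kp i y)"
  have iM: "i \<in> M" unfolding i_def using up(1) e(1) by blast
  have tM: "t \<in> M" unfolding t_def using up(1) e(1) iM by blast
  have i: "E w i \<longleftrightarrow> w = e" if "w \<in> M" for w unfolding i_def using up(2)[OF e(1) e(1) that] by simp
  have t: "E w t \<longleftrightarrow> w = e \<or> w = i" if "w \<in> M" for w unfolding t_def using up(2)[OF e(1) iM that] .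
  have fM: "f \<in> M" unfolding f_def using up(1) kp mem e(1) iM by blast
  have f: "E p f \<longleftrightarrow> p = kp e x \<or> p = kp i y" if "p \<in> M" for p
    unfolding f_def using up(2)[OF kp kp that] mem e(1) iM by blast
  have "e \<noteq> i" using i[OF e(1)] e by blast
  \<comment> \<open>By Extensionality the zero and the successors in an inductive set are the chosen
    ones, so two steps lead to \<open>t\<close>.\<close>
  have nat: "sat M E (case_nat t r) (is_nat 0)" for r
    unfolding sat_is_nat
  proof (intro ballI impI)
    fix I assume "sat M E (case_nat I (case_nat t r)) (is_inductive 0)"
    then obtain z where z: "z \<in> M" "E z I" "\<forall>w\<in>M. \<not> E w z"
      and step: "\<And>y. y \<in> M \<Longrightarrow> E y I \<Longrightarrow> \<exists>z\<in>M. E z I \<and> (\<forall>w\<in>M. E w z \<longleftrightarrow> E w y \<or> w = y)"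
      unfolding sat_is_inductive by auto
    have "z = e" using ext z e by blast
    then obtain j where j: "j \<in> M" "E j I" "\<forall>w\<in>M. E w j \<longleftrightarrow> E w e \<or> w = e" using step[OF e(1)] z by blast
    then have "j = i" using ext[OF j(1) iM] i e by blast
    then obtain l where l: "l \<in> M" "E l I" "\<forall>w\<in>M. E w l \<longleftrightarrow> E w i \<or> w = i" using step[OF iM] j by blast
    then have "l = t" using ext[OF l(1) tM] i t by blast
    then show "E (case_nat t r 0) I" using l by simp
  qed
  have tF: "E e t" "E i t" "E x F" "E y F" using t F e(1) iM mem by blast+
  have app: "(\<exists>p\<in>M. E p f \<and> op p a b) \<longleftrightarrow> a = e \<and> b = x \<or> a = i \<and> b = y" if "a \<in> M" "b \<in> M" for a b
  proof -
    have "(\<exists>p\<in>M. E p f \<and> op p a b) \<longleftrightarrow> E (kp a b) f" using op_iff kp that by blast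
    also have "\<dots> \<longleftrightarrow> kp a b = kp e x \<or> kp a b = kp i y" using f kp that by blast
    also have "\<dots> \<longleftrightarrow> a = e \<and> b = x \<or> a = i \<and> b = y"
      using kp_inject[OF _ that e(1) mem(1)] kp_inject[OF _ that iM mem(2)] by blast
    finally show ?thesis .
  qed
  have "(\<forall>p\<in>M. E p f \<longrightarrow> (\<exists>a\<in>M. E a t \<and> (\<exists>b\<in>M. E b F \<and> op p a b)))"
  proof (intro ballI impI)
    fix p assume p: "p \<in> M" "E p f"
    then consider "p = kp e x" | "p = kp i y" using f by blast
    then show "\<exists>a\<in>M. E a t \<and> (\<exists>b\<in>M. E b F \<and> op p a b)"
    proof cases
      case 1
      then have "op p e x" using op_iff[OF p(1) e(1) mem(1)] by blast
      then show ?thesis using tF mem e(1) by blast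
    next
      case 2
      then have "op p i y" using op_iff[OF p(1) iM mem(2)] by blast
      then show ?thesis using tF mem iM by blast
    qed
  qed
  moreover have "\<forall>a\<in>M. E a t \<longrightarrow> (\<exists>b\<in>M. E b F \<and> (\<exists>p\<in>M. E p f \<and> op p a b))"
  proof (intro ballI impI)
    fix a assume "a \<in> M" "E a t"
    then have "a = e \<or> a = i" using t by blast
    then show "\<exists>b\<in>M. E b F \<and> (\<exists>p\<in>M. E p f \<and> op p a b)"
      using app[OF e(1) mem(1)] app[OF iM mem(2)] tF mem by blast
  qed
  moreover have "\<forall>a\<in>M. \<forall>b\<in>M. \<forall>c\<in>M. (\<exists>p\<in>M. E p f \<and> op p a b) \<and> (\<exists>p\<in>M. E p f \<and> op p a c) \<longrightarrow> b = c"
    using app \<open>e \<noteq> i\<close> by metis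
  moreover have "\<forall>b\<in>M. E b F \<longrightarrow> (\<exists>a\<in>M. E a t \<and> (\<exists>p\<in>M. E p f \<and> op p a b))"
  proof (intro ballI impI)
    fix b assume "b \<in> M" "E b F"
    then have "b = x \<or> b = y" using F by blast
    then show "\<exists>a\<in>M. E a t \<and> (\<exists>p\<in>M. E p f \<and> op p a b)"
      using app[OF e(1) mem(1)] app[OF iM mem(2)] tF e(1) iM by blast
  qed
  moreover have "\<forall>a\<in>M. \<forall>b\<in>M. \<forall>c\<in>M. (\<exists>p\<in>M. E p f \<and> op p a c) \<and> (\<exists>p\<in>M. E p f \<and> op p b c) \<longrightarrow> a = b"
    using app neq by metis
  moreover have env: "case_nat f (case_nat t (case_nat F s)) 0 = f"
    "case_nat f (case_nat t (case_nat F s)) 1 = t" "case_nat f (case_nat t (case_nat F s)) (0 + 2) = F"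
    by (simp_all add: numeral_2_eq_2)
  ultimately have "sat M E (case_nat f (case_nat t (case_nat F s))) (is_bijection 0 1 (0 + 2))"
    unfolding sat_is_bijection env op_def by - (intro conjI; assumption)
  then show ?thesis
    unfolding is_finite_def sat_derived using tM fM nat by blast
qed

lemma not_sat_Finite_Union:
  assumes model: "is_model M E ZF_minus_Union"
    and mem: "x \<in> M" "y \<in> M" and no_union: "\<not> (\<exists>z\<in>M. \<forall>w\<in>M. E w z \<longleftrightarrow> E w x \<or> E w y)"
  shows "\<not> sat M E s Finite_Union"
proof
  assume *: "sat M E s Finite_Union"
  \<comment> \<open>Otherwise \<open>x\<close> would be the union.\<close>
  have "x \<noteq> y" using no_union mem(1) by blast
  have "range (\<lambda>_. x) \<subseteq> M" using mem(1) by auto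
  then have "sat M E (\<lambda>_. x) Pairing" using model unfolding is_model_ZF_minus_Union_iff by blast
  then obtain F where F: "F \<in> M" "\<forall>w\<in>M. E w F \<longleftrightarrow> w = x \<or> w = y"
    using mem unfolding sat_Pairing by blast
  have "sat M E (case_nat F s) (is_finite 0)"
    using sat_is_finite_upair[OF model mem F(1) \<open>x \<noteq> y\<close> F(2)] .
  then obtain u where "u \<in> M" "\<forall>w\<in>M. E w u \<longleftrightarrow> (\<exists>z\<in>M. E z F \<and> E w z)"
    using * F(1) unfolding sat_Finite_Union by blast
  then have "\<forall>w\<in>M. E w u \<longleftrightarrow> E w x \<or> E w y" using F(2) mem by auto
  then show False using no_union \<open>u \<in> M\<close> by blast
qed

section \<open>Reduction to a model on the natural numbers\<close>

text \<open>In a finite model Pairing and Union would collect all elements into one set, which would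
  be a member of itself, against Foundation.\<close>

lemma infinite_model_ZF:
  assumes "is_model V In ZF"
  shows "infinite V"
proof
  assume fin: "finite V"
  obtain v where v: "v \<in> V" using assms unfolding is_model_def by blast
  then have "range (\<lambda>_. v) \<subseteq> V" by auto
  then have ax: "sat V In (\<lambda>_. v) p" if "p \<in> {Foundation, Pairing, Defs.Union}" for p
    using assms that unfolding is_model_def ZF_def ZF_minus_Union_def by blast
  have pair: "\<exists>z\<in>V. \<forall>w\<in>V. In w z \<longleftrightarrow> w = a \<or> w = b" if "a \<in> V" "b \<in> V" for a b
    using ax[of Pairing] that unfolding sat_Pairing by blast
  have union: "\<exists>u\<in>V. \<forall>w\<in>V. In w u \<longleftrightarrow> (\<exists>x\<in>V. In x a \<and> In w x)" if "a \<in> V" for a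
    using ax[of Defs.Union] that unfolding sat_Union by blast
  have "\<exists>z\<in>V. \<forall>a\<in>A. In a z" if "finite A" "A \<subseteq> V" for A
    using that
  proof (induction A rule: finite_induct)
    case empty
    then show ?case using v by blast
  next
    case (insert a A)
    then obtain z where z: "z \<in> V" "\<forall>a\<in>A. In a z" by blast
    have "a \<in> V" using insert.prems by blast
    obtain q where q: "q \<in> V" "\<forall>w\<in>V. In w q \<longleftrightarrow> w = a \<or> w = a"
      using pair[OF \<open>a \<in> V\<close> \<open>a \<in> V\<close>] by blast
    obtain r where r: "r \<in> V" "\<forall>w\<in>V. In w r \<longleftrightarrow> w = z \<or> w = q" using pair[OF z(1) q(1)] by blast
    obtain u where u: "u \<in> V" "\<forall>w\<in>V. In w u \<longleftrightarrow> (\<exists>x\<in>V. In x r \<and> In w x)" using union[OF r(1)] by blast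
    have "In z r" "In q r" using r z(1) q(1) by auto
    have "In b u" if b: "b \<in> insert a A" for b
    proof -
      have "b \<in> V" using b insert.prems by blast
      moreover have "In b z \<or> In b q" using b z(2) q(2) \<open>a \<in> V\<close> by blast
      ultimately show ?thesis using u(2) \<open>In z r\<close> \<open>In q r\<close> z(1) q(1) by blast
    qed
    then show ?case using u(1) by blast
  qed
  then obtain z where z: "z \<in> V" "In z z" using fin by blast
  obtain q where q: "q \<in> V" "\<forall>w\<in>V. In w q \<longleftrightarrow> w = z \<or> w = z" using pair[OF z(1) z(1)] by blast
  then have "In z q" using z(1) by blast
  have "sat V In (\<lambda>_. v) Foundation" using ax by blast
  then have "(\<exists>y\<in>V. In y q) \<longrightarrow> (\<exists>y\<in>V. In y q \<and> \<not> (\<exists>x\<in>V. In x q \<and> In x y))"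
    unfolding sat_Foundation using q(1) by (rule bspec)
  then have "\<exists>y\<in>V. In y q \<and> \<not> (\<exists>x\<in>V. In x q \<and> In x y)"
    by (rule mp) (use z(1) \<open>In z q\<close> in blast)
  then obtain y where y: "y \<in> V" "In y q" "\<not> (\<exists>x\<in>V. In x q \<and> In x y)" by (elim bexE conjE)
  have "y = z" using q(2) y(1,2) by simp
  then show False using y(3) z \<open>In z q\<close> by simp
qed

text \<open>The construction takes a whole type as its carrier. A countable elementary substructure
  provides this over \<open>nat\<close>, whatever the size of \<open>V\<close>.\<close>

lemma ex_model_on_nat:
  assumes "is_model V In ZF"
  obtains mem :: "nat \<Rightarrow> nat \<Rightarrow> bool" where "is_model UNIV mem ZF"
proof -
  have "V \<noteq> {}" using assms unfolding is_model_def by blast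
  then obtain H where H: "H \<subseteq> V" "H \<noteq> {}" "countable H"
      "\<And>s p. range s \<subseteq> H \<Longrightarrow> sat H In s p \<longleftrightarrow> sat V In s p"
    by (rule countable_elementary_substructure[where E = In]) blast
  have model: "is_model H In ZF" unfolding is_model_def
  proof (intro conjI ballI allI impI)
    fix p and s :: "nat \<Rightarrow> _" assume "p \<in> ZF" and s: "range s \<subseteq> H"
    then have "sat V In s p" using assms H(1) unfolding is_model_def by blast
    then show "sat H In s p" using H(4)[OF s] by blast
  qed fact
  have bij: "bij_betw (to_nat_on H) H UNIV"
    using to_nat_on_infinite[OF H(3) infinite_model_ZF[OF model]] .
  have "is_model (to_nat_on H ` H) (\<lambda>a b. In (from_nat_into H a) (from_nat_into H b)) ZF"
    by (rule is_model_image_iso[OF _ _ model]) (use H(3) bij in \<open>auto simp: bij_betw_def\<close>)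
  then show thesis using that bij unfolding bij_betw_def by auto
qed

theorem theorem3:
  fixes V :: "'v set" and In :: "'v \<Rightarrow> 'v \<Rightarrow> bool"
  assumes metatheory: "is_model V In ZF"
  shows "\<not> ZF_minus_Union \<turnstile> Finite_Union \<and>
    (\<exists>(M :: 'v set) E. is_model M E ZF_minus_Union \<and>
       (\<exists>x\<in>M. \<exists>y\<in>M. \<not> (\<exists>z\<in>M. \<forall>w\<in>M. E w z \<longleftrightarrow> E w x \<or> E w y)))"
proof -
  obtain mem :: "nat \<Rightarrow> nat \<Rightarrow> bool" where "is_model UNIV mem ZF"
    using ex_model_on_nat[OF metatheory] by blast
  then interpret zf mem by unfold_locales
  obtain x y where xy: "x \<in> M" "y \<in> M" "\<not> (\<exists>z\<in>M. \<forall>w\<in>M. E w z \<longleftrightarrow> E w x \<or> E w y)"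
    using M_no_union by blast
  have "\<not> ZF_minus_Union \<turnstile> Finite_Union"
    using not_proves_if_model[OF M_model, of "\<lambda>_. x"] not_sat_Finite_Union[OF M_model xy] xy(1) by auto
  \<comment> \<open>The model is demanded on a set of type \<open>'v\<close>; infinity of
    \<open>V\<close> gives an injection carrying it back there.\<close>
  moreover obtain f :: "nat \<Rightarrow> 'v" where f: "inj f"
    using infinite_countable_subset[OF infinite_model_ZF[OF metatheory]] by blast
  define E' where "E' a b \<longleftrightarrow> E (inv f a) (inv f b)" for a b
  have E': "E' (f a) (f b) \<longleftrightarrow> E a b" for a b unfolding E'_def using f by simp
  have "is_model (f ` M) E' ZF_minus_Union"
    by (rule is_model_image_iso[OF _ _ M_model]) (use E' f in \<open>auto intro: inj_on_subset\<close>)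
  moreover have "\<exists>x\<in>f ` M. \<exists>y\<in>f ` M. \<not> (\<exists>z\<in>f ` M. \<forall>w\<in>f ` M. E' w z \<longleftrightarrow> E' w x \<or> E' w y)"
    using xy by (simp add: E') blast
  ultimately show ?thesis by blast
qed

end
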